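(* Consider Algorithm AR-QPRSGD (described in the context) under the smoothness and bounded variance assumptions in the context (constants $L>0$, $\sigma,\kappa\ge0$). Suppose the number of workers satisfies $$M\le d\left(1+\frac{d}{4s^2}\right)\left(\exp\left(\frac{d}{4s^2}\right)-\frac{d}{4s^2}-1\right)^{-1}$$ and the number of local updates satisfies $K\le\frac{\sigma^2}{2\kappa^2}\left(1+2\exp\left(-\frac{d}{4s^2}\right)\right)$. With the constant stepsize $\gamma_n=\bar\gamma=\frac{\sqrt M}{L\sqrt{NK}}$, the algorithm achieves the ergodic convergence rate $O\left(1/\sqrt{NKM}\right)$; that is, for $N$ sufficiently large, $$\frac{1}{NK}\sum_{n=1}^N\sum_{k=0}^{K-1}\mathbb{E}\|\nabla F(\bar{x}_{n;k})\|_2^2=O\left(\frac{1}{\sqrt{NKM}}\right).$$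
   Context: Convention. All quantities except $N$, $M$, $K$ (i.e. $L,\sigma,\kappa,d,s,F(\tilde{x}_1)-F_*$) are treated as fixed hyper-parameters, so the constant in $O(\cdot)$ may depend on them but not on $N,M,K$; $N$ is assumed sufficiently large (the threshold may depend on the other quantities). If $\kappa=0$ the bound on $K$ is void. Problem. There are $M$ workers; worker $m$ has data distribution $\mathcal{D}_m$ and loss $f_m(x,\xi)$, $x\in\mathbb{R}^d$. Put $F_m(x)=\mathbb{E}_{\xi\sim\mathcal{D}_m}[f_m(x,\xi)]$ and $F=\frac1M\sum_{m=1}^M F_m$. $F_*$ is the (finite) optimal value of $\min_{x\in\mathbb{R}^d}F(x)$. The objective need not be convex. Stochastic gradients are unbiased: $\mathbb{E}_{\xi\sim\mathcal{D}_m}\nabla f_m(x,\xi)=\nabla F_m(x)$. Assumptions. (Smoothness) every $F_m$ is continuously differentiable with $L$-Lipschitz gradient, $L>0$. (Bounded variance) there are $\sigma,\kappa\ge0$ such that for all $m$ and $x\in\mathbb{R}^d$: $\mathbb{E}_{\xi\sim\mathcal{D}_m}\|\nabla f_m(x,\xi)-\nabla F_m(x)\|_2^2\le\sigma^2$ and $\frac1M\sum_{m=1}^M\|\nabla F(x)-\nabla F_m(x)\|_2^2\le\kappa^2$. Quantizer. For an integer $s\ge1$ and a nonzero vector $v$, $Q_s(v)$ is the random vector with independent coordinates $Q_s(v)_i=\|v\|_2\,\mathrm{sgn}(v_i)\,\zeta(v_i,s)/s$, where, with $\ell\in\{0,\dots,s-1\}$ an integer such that $|v_i|/\|v\|_2\in[\ell/s,(\ell+1)/s]$,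 $\zeta(v_i,s)=\ell+1$ with probability $\frac{|v_i|}{\|v\|_2}s-\ell$ and $\zeta(v_i,s)=\ell$ otherwise; $Q_s(0)=0$. Different applications use independent randomness. Algorithm AR-QPRSGD (Ring All-Reduce). Let $K\ge1$ be the number of local updates per synchronization, $\{\gamma_n\}$ the stepsizes, and $\tilde{x}_1\in\mathbb{R}^d$ the initial point. For $n=1,2,\dots,N$: each worker $m$ sets $x_{n;0}^{(m)}=\tilde{x}_n$ and, for $k=0,\dots,K-1$, draws a fresh independent sample $\xi_k^{(m)}\sim\mathcal{D}_m$ and sets $x_{n;k+1}^{(m)}=x_{n;k}^{(m)}-\gamma_n\nabla f_m(x_{n;k}^{(m)},\xi_k^{(m)})$. Put $g_n^{(m)}=x_{n;0}^{(m)}-x_{n;K}^{(m)}$. Then $$\tilde{x}_{n+1}=\tilde{x}_n-\frac1M Q_s\left(\dots Q_s\left(Q_s\left(g_n^{(1)}\right)+g_n^{(2)}\right)+\dots+g_n^{(M)}\right),$$ where the recursive compression is carried out segmentwise: each vector of $\mathbb{R}^d$ is split into $M$ consecutive segments in $\mathbb{R}^{d/M}$ ($M$ divides $d$), and for each segment $j$ the nested quantized sum is computed with $Q_s$ acting on $\mathbb{R}^{d/M}$, the workers being visited in the cyclic order of the ring starting with worker $j$. Finally $\bar{x}_{n;k}=\frac1M\sum_{m=1}^M x_{n;k}^{(m)}$. *)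

theory Defs
  imports "HOL-Probability.Probability"
begin

definition grad :: "(real ^ 'd \<Rightarrow> real) \<Rightarrow> real ^ 'd \<Rightarrow> real ^ 'd" where
  "grad h x = (THE v. GDERIV h x :> v)"

lemma grad_eqI:
  fixes h :: "real ^ 'd \<Rightarrow> real"
  assumes "GDERIV h x :> v"
  shows "grad h x = v"
  unfolding grad_def
proof (rule the_equality)
  show "GDERIV h x :> v" by (fact assms)
next
  fix w assume "GDERIV h x :> w"
  then have eq: "(\<lambda>y. y \<bullet> w) = (\<lambda>y. y \<bullet> v)"
    using assms unfolding gderiv_def by (rule has_derivative_unique)
  have "\<forall>y. y \<bullet> w = y \<bullet> v"
    using fun_cong[OF eq] by simp
  then show "w = v"
    by (simp only: vector_eq_ldot)
qed

lemma grad_works: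
  fixes h :: "real ^ 'd \<Rightarrow> real"
  assumes "h differentiable (at x)"
  shows "GDERIV h x :> grad h x"
proof -
  obtain h' where h': "(h has_derivative h') (at x)"
    using assms by (auto simp: differentiable_def)
  then have lin: "linear h'"
    by (rule has_derivative_linear)
  define w where "w = adjoint h' 1"
  have "h' = (\<lambda>y. y \<bullet> w)"
  proof
    fix y show "h' y = y \<bullet> w"
      using adjoint_works[OF lin, of y 1] by (simp add: w_def)
  qed
  with h' have "GDERIV h x :> w"
    unfolding gderiv_def by simp
  then show ?thesis
    by (simp only: grad_eqI)
qed

text \<open>
  Workers are numbered \<open>0, \<dots>, M - 1\<close>; worker \<open>m\<close> has data distribution \<open>D m\<close> and loss
  \<open>f m x \<xi>\<close>.
\<close>

definition worker_obj ::
    "(nat \<Rightarrow> 'w measure) \<Rightarrow> (nat \<Rightarrow> real ^ 'd \<Rightarrow> 'w \<Rightarrow> real) \<Rightarrow> nat \<Rightarrow> real ^ 'd \<Rightarrow> real" where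
  "worker_obj D f m x = (\<integral>\<xi>. f m x \<xi> \<partial>D m)"

definition objective ::
    "nat \<Rightarrow> (nat \<Rightarrow> 'w measure) \<Rightarrow> (nat \<Rightarrow> real ^ 'd \<Rightarrow> 'w \<Rightarrow> real) \<Rightarrow> real ^ 'd \<Rightarrow> real" where
  "objective M D f x = (1 / real M) * (\<Sum>m<M. worker_obj D f m x)"

definition stoch_grad ::
    "(nat \<Rightarrow> real ^ 'd \<Rightarrow> 'w \<Rightarrow> real) \<Rightarrow> nat \<Rightarrow> real ^ 'd \<Rightarrow> 'w \<Rightarrow> real ^ 'd" where
  "stoch_grad f m x \<xi> = grad (\<lambda>y. f m y \<xi>) x"

text \<open>
  No joint measurability of \<open>f m\<close> or of its gradient in \<open>(x, \<xi>)\<close> is required: it follows from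
  measurability in \<open>\<xi>\<close> and differentiability in \<open>x\<close>. The optimal value is the infimum of the
  objective; it need not be attained.
\<close>

definition stochastic_problem ::
    "nat \<Rightarrow> (nat \<Rightarrow> 'w measure) \<Rightarrow> (nat \<Rightarrow> real ^ 'd \<Rightarrow> 'w \<Rightarrow> real) \<Rightarrow> bool" where
  "stochastic_problem M D f \<longleftrightarrow>
     (\<forall>m<M. prob_space (D m)) \<and>
     (\<forall>m<M. \<forall>x. integrable (D m) (f m x)) \<and>
     (\<forall>m<M. \<forall>\<xi>\<in>space (D m). \<forall>x. (\<lambda>y. f m y \<xi>) differentiable (at x)) \<and>
     (\<forall>m<M. \<forall>x. integrable (D m) (stoch_grad f m x) \<and>
        (\<integral>\<xi>. stoch_grad f m x \<xi> \<partial>D m) = grad (worker_obj D f m) x) \<and>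
     bdd_below (range (objective M D f))"

definition optimal_value ::
    "nat \<Rightarrow> (nat \<Rightarrow> 'w measure) \<Rightarrow> (nat \<Rightarrow> real ^ 'd \<Rightarrow> 'w \<Rightarrow> real) \<Rightarrow> real" where
  "optimal_value M D f = (INF x. objective M D f x)"

definition smooth_workers ::
    "nat \<Rightarrow> (nat \<Rightarrow> 'w measure) \<Rightarrow> (nat \<Rightarrow> real ^ 'd \<Rightarrow> 'w \<Rightarrow> real) \<Rightarrow> real \<Rightarrow> bool" where
  "smooth_workers M D f L \<longleftrightarrow>
     (\<forall>m<M. (\<forall>x. worker_obj D f m differentiable (at x)) \<and>
        continuous_on UNIV (grad (worker_obj D f m)) \<and>
        L-lipschitz_on UNIV (grad (worker_obj D f m)))"

definition bounded_variance ::
    "nat \<Rightarrow> (nat \<Rightarrow> 'w measure) \<Rightarrow> (nat \<Rightarrow> real ^ 'd \<Rightarrow> 'w \<Rightarrow> real) \<Rightarrow> real \<Rightarrow> real \<Rightarrow> bool" where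
  "bounded_variance M D f \<sigma> \<kappa> \<longleftrightarrow>
     (\<forall>m<M. \<forall>x.
        integrable (D m) (\<lambda>\<xi>. (norm (stoch_grad f m x \<xi> - grad (worker_obj D f m) x))\<^sup>2) \<and>
        (\<integral>\<xi>. (norm (stoch_grad f m x \<xi> - grad (worker_obj D f m) x))\<^sup>2 \<partial>D m) \<le> \<sigma>\<^sup>2) \<and>
     (\<forall>x. (1 / real M) *
        (\<Sum>m<M. (norm (grad (objective M D f) x - grad (worker_obj D f m) x))\<^sup>2) \<le> \<kappa>\<^sup>2)"

text \<open>
  The random variables \<open>\<zeta>(v\<^sub>i, s)\<close> are realized by seeds \<open>u i\<close>, independent and uniform on
  \<open>[0, 1]\<close>: the event \<open>u i < p\<close> has probability \<open>p\<close>. When the ratio \<open>r = \<bar>v\<^sub>i\<bar> / \<parallel>v\<parallel>\<close> is a grid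
  point two levels are admissible; the distribution of the result does not depend on the choice.
\<close>

definition quant_level :: "nat \<Rightarrow> real \<Rightarrow> nat" where
  "quant_level s r = (LEAST l. l < s \<and> r \<in> {real l / real s .. (real l + 1) / real s})"

definition quant_zeta :: "nat \<Rightarrow> real \<Rightarrow> real \<Rightarrow> real" where
  "quant_zeta s r t =
     (if t < r * real s - real (quant_level s r) then real (quant_level s r) + 1
      else real (quant_level s r))"

definition quantize :: "nat \<Rightarrow> ('d \<Rightarrow> real) \<Rightarrow> real ^ 'd \<Rightarrow> real ^ 'd" where
  "quantize s u v =
     (if v = 0 then 0
      else (\<chi> i. norm v * sgn (v $ i) * quant_zeta s (\<bar>v $ i\<bar> / norm v) (u i) / real s))"

lemma quant_level_works:
  assumes "s \<ge> 1" "0 \<le> r" "r \<le> 1"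
  shows "quant_level s r < s" "r \<in> {real (quant_level s r) / real s .. (real (quant_level s r) + 1) / real s}"
proof -
  have "\<exists>l. l < s \<and> r \<in> {real l / real s .. (real l + 1) / real s}"
  proof (cases "r = 1")
    case True
    then show ?thesis
      using assms by (intro exI[of _ "s - 1"]) (auto simp: field_simps of_nat_diff)
  next
    case False
    define l where "l = nat \<lfloor>r * real s\<rfloor>"
    have l: "real l \<le> r * real s" "r * real s < real l + 1"
      using assms unfolding l_def by (auto simp: of_nat_floor)
    have "r * real s < real s"
      using False assms by simp
    then have "l < s"
      using l by linarith
    then show ?thesis
      using l assms by (intro exI[of _ l]) (auto simp: field_simps)
  qed
  from LeastI_ex[OF this]
  show "quant_level s r < s" "r \<in> {real (quant_level s r) / real s .. (real (quant_level s r) + 1) / real s}"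
    unfolding quant_level_def by auto
qed

lemma prob_quant_zeta:
  assumes "s \<ge> 1" "0 \<le> r" "r \<le> 1"
  shows "measure (uniform_measure lborel {0..1::real}) {t. quant_zeta s r t = real (quant_level s r) + 1}
           = r * real s - real (quant_level s r)"
proof -
  define p where "p = r * real s - real (quant_level s r)"
  have p: "0 \<le> p" "p \<le> 1"
    using quant_level_works(2)[OF assms] assms(1) unfolding p_def by (auto simp: field_simps)
  have eq: "{t. quant_zeta s r t = real (quant_level s r) + 1} = {..<p}"
    unfolding quant_zeta_def p_def by auto
  have int: "{0..1} \<inter> {..<p} = {0..<p}"
    using p by auto
  have "measure (uniform_measure lborel {0..1::real}) {..<p} = p"
    using p by (subst measure_uniform_measure) (auto simp: int)
  then show ?thesis
    unfolding eq by (simp add: p_def)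
qed

text \<open>
  A segment, an element of \<open>\<real>\<^bsup>d/M\<^esup>\<close>, is represented as the vector of \<open>\<real>\<^sup>d\<close> that vanishes outside
  its block of coordinates. This embedding preserves the norm and commutes with the quantizer,
  because a zero coordinate is quantized to zero. The coordinates are ordered by the linear order
  on the index type.
\<close>

definition coord_index :: "'d :: {finite, linorder} \<Rightarrow> nat" where
  "coord_index i = card {i'. i' < i}"

definition segment :: "nat \<Rightarrow> nat \<Rightarrow> 'd :: {finite, linorder} set" where
  "segment M j = {i. coord_index i div (CARD('d) div M) = j}"

definition seg_part :: "nat \<Rightarrow> nat \<Rightarrow> real ^ ('d :: {finite, linorder}) \<Rightarrow> real ^ ('d :: {finite, linorder})" where
  "seg_part M j v = (\<chi> i. if i \<in> segment M j then v $ i else 0)"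

primrec nested_quant ::
    "nat \<Rightarrow> (nat \<Rightarrow> 'd \<Rightarrow> real) \<Rightarrow> (nat \<Rightarrow> real ^ 'd) \<Rightarrow> nat \<Rightarrow> real ^ 'd" where
  "nested_quant s u h 0 = quantize s (u 0) (h 0)"
| "nested_quant s u h (Suc t) = quantize s (u (Suc t)) (nested_quant s u h t + h (Suc t))"

text \<open>Segment \<open>j\<close> visits the workers \<open>j, j + 1, \<dots>, M - 1, 0, \<dots>, j - 1\<close>.\<close>

definition quantized_all_reduce ::
    "nat \<Rightarrow> nat \<Rightarrow> (nat \<Rightarrow> nat \<Rightarrow> 'd \<Rightarrow> real) \<Rightarrow> (nat \<Rightarrow> real ^ ('d :: {finite, linorder})) \<Rightarrow>
      real ^ ('d :: {finite, linorder})" where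
  "quantized_all_reduce M s u g =
     (\<Sum>j<M. nested_quant s (u j) (\<lambda>t. seg_part M j (g ((j + t) mod M))) (M - 1))"

text \<open>
  The iterates are functions of the realized samples \<open>\<xi> n k m\<close> and quantization seeds
  \<open>u n j t i\<close> (round \<open>n\<close>, segment \<open>j\<close>, position \<open>t\<close> on the ring, coordinate \<open>i\<close>). Rounds are
  counted from \<open>0\<close>, so \<open>ar_iterate \<dots> n\<close> is the iterate with index \<open>n + 1\<close> in one-based counting
  and \<open>\<gamma> n\<close> is the stepsize of that round.
\<close>

primrec local_sgd ::
    "(real ^ 'd \<Rightarrow> 'w \<Rightarrow> real ^ 'd) \<Rightarrow> real \<Rightarrow> (nat \<Rightarrow> 'w) \<Rightarrow> real ^ 'd \<Rightarrow> nat \<Rightarrow> real ^ 'd" where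
  "local_sgd G c z x 0 = x"
| "local_sgd G c z x (Suc k) = local_sgd G c z x k - c *\<^sub>R G (local_sgd G c z x k) (z k)"

primrec ar_iterate ::
    "nat \<Rightarrow> nat \<Rightarrow> nat \<Rightarrow> (nat \<Rightarrow> real ^ ('d :: {finite, linorder}) \<Rightarrow> 'w \<Rightarrow> real) \<Rightarrow>
      (nat \<Rightarrow> real) \<Rightarrow> real ^ ('d :: {finite, linorder}) \<Rightarrow> (nat \<Rightarrow> nat \<Rightarrow> nat \<Rightarrow> 'w) \<Rightarrow>
      (nat \<Rightarrow> nat \<Rightarrow> nat \<Rightarrow> 'd \<Rightarrow> real) \<Rightarrow> nat \<Rightarrow> real ^ ('d :: {finite, linorder})" where
  "ar_iterate M K s f \<gamma> x1 \<xi> u 0 = x1"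
| "ar_iterate M K s f \<gamma> x1 \<xi> u (Suc n) =
     (let x = ar_iterate M K s f \<gamma> x1 \<xi> u n;
          g = (\<lambda>m. x - local_sgd (stoch_grad f m) (\<gamma> n) (\<lambda>k. \<xi> n k m) x K)
      in x - (1 / real M) *\<^sub>R quantized_all_reduce M s (u n) g)"

definition ar_average ::
    "nat \<Rightarrow> nat \<Rightarrow> nat \<Rightarrow> (nat \<Rightarrow> real ^ ('d :: {finite, linorder}) \<Rightarrow> 'w \<Rightarrow> real) \<Rightarrow>
      (nat \<Rightarrow> real) \<Rightarrow> real ^ ('d :: {finite, linorder}) \<Rightarrow> (nat \<Rightarrow> nat \<Rightarrow> nat \<Rightarrow> 'w) \<Rightarrow>
      (nat \<Rightarrow> nat \<Rightarrow> nat \<Rightarrow> 'd \<Rightarrow> real) \<Rightarrow> nat \<Rightarrow> nat \<Rightarrow> real ^ ('d :: {finite, linorder})" where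
  "ar_average M K s f \<gamma> x1 \<xi> u n k =
     (1 / real M) *\<^sub>R (\<Sum>m<M. local_sgd (stoch_grad f m) (\<gamma> n) (\<lambda>k. \<xi> n k m)
                              (ar_iterate M K s f \<gamma> x1 \<xi> u n) k)"

datatype 'd draw = Sample nat nat nat | Seed nat nat nat 'd

primrec draw_events ::
    "'p measure \<Rightarrow> (nat \<Rightarrow> 'w measure) \<Rightarrow> (nat \<Rightarrow> nat \<Rightarrow> nat \<Rightarrow> 'p \<Rightarrow> 'w) \<Rightarrow>
      (nat \<Rightarrow> nat \<Rightarrow> nat \<Rightarrow> 'd \<Rightarrow> 'p \<Rightarrow> real) \<Rightarrow> 'd draw \<Rightarrow> 'p set set" where
  "draw_events P D \<xi> u (Sample n k m) = {\<xi> n k m -` A \<inter> space P |A. A \<in> sets (D m)}"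
| "draw_events P D \<xi> u (Seed n j t i) = {u n j t i -` A \<inter> space P |A. A \<in> sets borel}"

text \<open>
  Independence is stated for the generated \<open>\<sigma>\<close>-algebras, since the samples and the seeds take
  values in different types.
\<close>

definition algorithm_randomness ::
    "nat \<Rightarrow> nat \<Rightarrow> nat \<Rightarrow> (nat \<Rightarrow> 'w measure) \<Rightarrow> 'p measure \<Rightarrow>
      (nat \<Rightarrow> nat \<Rightarrow> nat \<Rightarrow> 'p \<Rightarrow> 'w) \<Rightarrow>
      (nat \<Rightarrow> nat \<Rightarrow> nat \<Rightarrow> 'd :: {finite, linorder} \<Rightarrow> 'p \<Rightarrow> real) \<Rightarrow> bool" where
  "algorithm_randomness N M K D P \<xi> u \<longleftrightarrow>
     prob_space P \<and>
     (\<forall>n<N. \<forall>k<K. \<forall>m<M. \<xi> n k m \<in> measurable P (D m) \<and> distr P (D m) (\<xi> n k m) = D m) \<and>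
     (\<forall>n<N. \<forall>j<M. \<forall>t<M. \<forall>i\<in>segment M j.
        u n j t i \<in> borel_measurable P \<and>
        distr P lborel (u n j t i) = uniform_measure lborel {0..1}) \<and>
     prob_space.indep_sets P (draw_events P D \<xi> u)
       ({Sample n k m |n k m. n < N \<and> k < K \<and> m < M} \<union>
        {Seed n j t i |n j t i. n < N \<and> j < M \<and> t < M \<and> i \<in> segment M j})"

end

theory Submission
  imports Defs
begin

text \<open>
  Since \<open>M\<close> divides \<open>d\<close>, constants may depend on \<open>M\<close>, so no variance reduction across
  workers is needed and the quantization error is bounded pathwise by a multiple (depending on
  \<open>d\<close>) of the norms of the local updates; only its unbiasedness is probabilistic. The estimate has
  to be uniform in \<open>K\<close>, however, because \<open>K\<close> is unbounded when \<open>\<kappa> = 0\<close>. This comes from the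
  orthogonality of successive gradient noises, which makes the noise part of a local update of size
  \<open>K \<gamma>\<^sup>2 \<sigma>\<^sup>2\<close> rather than \<open>K\<^sup>2 \<gamma>\<^sup>2 \<sigma>\<^sup>2\<close>. All other terms carry a further factor \<open>\<gamma>\<close> times
  a power of \<open>K\<close> and are absorbed for large \<open>N\<close>, the heterogeneity through
  \<open>K \<kappa>\<^sup>2 \<le> 2 \<sigma>\<^sup>2\<close>. Each round then decreases the expected objective by \<open>\<gamma>/4\<close> times the sum of
  the squared gradient norms, up to \<open>O(K \<gamma>\<^sup>2)\<close>, and the bounds telescope.
\<close>

subsection \<open>Gradients and measurability\<close>

text \<open>No conditional expectation is formed. A sigma-algebra is attached to every set of draws;
  "known" means measurable for such a set, "fresh" means that a draw lies outside it, and
  unbiasedness becomes orthogonality to all square-integrable functions of the known draws. Fubini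
  gives this for one fresh draw at a time, for samples and seeds alike, and each segment of the ring
  may keep its own order of events.

  The descent estimate is circular: the drift of the local iterates from the start of the round is
  bounded by the local gradients, and these by the gradient of the objective, the heterogeneity and
  again the drift. The circle closes because the drift returns with a factor of order
  \<open>(K * c * L)\<^sup>2\<close>, where \<open>c\<close> is the stepsize. Drift reaches the
  objective only at order \<open>c ^ 3\<close>, so its noise may be summed crudely; the quantization
  error reaches it at order \<open>c\<^sup>2\<close>, the order of the final bound, and only there
  is the orthogonality between successive noises needed.\<close>

lemma norm_sum_power2_le:
  fixes v :: "'i \<Rightarrow> 'v :: real_normed_vector"
  assumes "finite I"
  shows "(norm (\<Sum>i\<in>I. v i))\<^sup>2 \<le> real (card I) * (\<Sum>i\<in>I. (norm (v i))\<^sup>2)"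
proof -
  have "(norm (\<Sum>i\<in>I. v i))\<^sup>2 \<le> (\<Sum>i\<in>I. norm (v i))\<^sup>2"
    by (intro power_mono norm_sum) simp
  also have "\<dots> \<le> real (card I) * (\<Sum>i\<in>I. (norm (v i))\<^sup>2)"
    using sum_squared_le_sum_of_squares[of "\<lambda>i. norm (v i)" I] assms by (simp add: mult.commute)
  finally show ?thesis .
qed

lemma norm_add_power2_le:
  fixes a b :: "'v :: real_normed_vector"
  shows "(norm (a + b))\<^sup>2 \<le> 2 * (norm a)\<^sup>2 + 2 * (norm b)\<^sup>2"
  using norm_sum_power2_le[of "{0, 1 :: nat}" "\<lambda>i. if i = 0 then a else b"] by simp

lemma norm_diff_power2_le:
  fixes a b :: "'v :: real_normed_vector"
  shows "(norm (a - b))\<^sup>2 \<le> 2 * (norm a)\<^sup>2 + 2 * (norm b)\<^sup>2"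
  using norm_add_power2_le[of a "- b"] by simp

lemma norm_average_power2_le:
  fixes v :: "nat \<Rightarrow> 'v :: real_normed_vector"
  assumes "M \<ge> 1"
  shows "(norm ((1 / real M) *\<^sub>R (\<Sum>m<M. v m)))\<^sup>2 \<le> (1 / real M) * (\<Sum>m<M. (norm (v m))\<^sup>2)"
proof -
  have "(norm ((1 / real M) *\<^sub>R (\<Sum>m<M. v m)))\<^sup>2 = (1 / real M)\<^sup>2 * (norm (\<Sum>m<M. v m))\<^sup>2"
    by (simp add: power_mult_distrib power_divide)
  also have "\<dots> \<le> (1 / real M)\<^sup>2 * (real M * (\<Sum>m<M. (norm (v m))\<^sup>2))"
    using norm_sum_power2_le[of "{..<M}" v] by (intro mult_left_mono) auto
  also have "\<dots> = (1 / real M) * (\<Sum>m<M. (norm (v m))\<^sup>2)"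
    using assms by (simp add: power2_eq_square)
  finally show ?thesis .
qed

lemma abs_inner_le_power2:
  fixes a b :: "'v :: real_inner"
  shows "\<bar>a \<bullet> b\<bar> \<le> (norm a)\<^sup>2 + (norm b)\<^sup>2"
proof -
  have "\<bar>a \<bullet> b\<bar> \<le> norm a * norm b" by (rule Cauchy_Schwarz_ineq2)
  moreover have "0 \<le> (norm a - norm b)\<^sup>2" by simp
  moreover have "0 \<le> norm a * norm b" by simp
  ultimately show ?thesis by (simp add: power2_diff)
qed

text \<open>A single use of the mean value theorem on the segment gives \<open>L\<close> where
  integration would give \<open>L / 2\<close>. The two-sided form serves both the descent steps and
  the integrability of the objective along the iterates.\<close>

lemma mean_value_gradient:
  fixes h :: "real ^ 'd \<Rightarrow> real"
  assumes diff: "\<And>x. h differentiable (at x)"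
    and lip: "L-lipschitz_on UNIV (grad h)"
  shows "\<bar>h y - h x - grad h x \<bullet> (y - x)\<bar> \<le> L * (norm (y - x))\<^sup>2"
proof -
  have D: "((\<lambda>t. h (x + t *\<^sub>R (y - x))) has_real_derivative
             (y - x) \<bullet> grad h (x + t *\<^sub>R (y - x))) (at t)" for t
  proof -
    have lin: "((\<lambda>t. x + t *\<^sub>R (y - x)) has_derivative (\<lambda>r. r *\<^sub>R (y - x))) (at t)"
      by (auto intro!: derivative_eq_intros)
    have "(h has_derivative (\<lambda>z. z \<bullet> grad h (x + t *\<^sub>R (y - x)))) (at (x + t *\<^sub>R (y - x)))"
      using grad_works[OF diff] by (simp add: gderiv_def)
    then have "((\<lambda>t. h (x + t *\<^sub>R (y - x))) has_derivative
        (\<lambda>r. (r *\<^sub>R (y - x)) \<bullet> grad h (x + t *\<^sub>R (y - x)))) (at t)"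
      by (rule has_derivative_compose[of "\<lambda>t. x + t *\<^sub>R (y - x)" "\<lambda>r. r *\<^sub>R (y - x)" t UNIV h, OF lin])
    then show ?thesis
      by (simp add: has_field_derivative_def mult_commute_abs)
  qed
  obtain z where z: "0 < z" "z < 1"
      "h (x + 1 *\<^sub>R (y - x)) - h (x + 0 *\<^sub>R (y - x)) = (1 - 0) * ((y - x) \<bullet> grad h (x + z *\<^sub>R (y - x)))"
    using MVT2[of 0 1 "\<lambda>t. h (x + t *\<^sub>R (y - x))", OF _ D] by auto
  have "norm (grad h (x + z *\<^sub>R (y - x)) - grad h x) \<le> L * (z * norm (y - x))"
    using lipschitz_onD[OF lip, of "x + z *\<^sub>R (y - x)" x] z by (simp add: dist_norm)
  also have "\<dots> \<le> L * norm (y - x)"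
    using z lipschitz_on_nonneg[OF lip] by (intro mult_left_mono) (auto intro: mult_left_le_one_le)
  finally have g: "norm (grad h (x + z *\<^sub>R (y - x)) - grad h x) \<le> L * norm (y - x)" .
  have "h y - h x - grad h x \<bullet> (y - x) = (y - x) \<bullet> (grad h (x + z *\<^sub>R (y - x)) - grad h x)"
    using z by (simp add: inner_diff_right inner_commute)
  also have "\<bar>\<dots>\<bar> \<le> norm (y - x) * norm (grad h (x + z *\<^sub>R (y - x)) - grad h x)"
    by (rule Cauchy_Schwarz_ineq2)
  also have "\<dots> \<le> norm (y - x) * (L * norm (y - x))"
    using g by (intro mult_left_mono) auto
  finally show ?thesis by (simp add: power2_eq_square mult_ac)
qed

text \<open>Only separate regularity is assumed, so the first variable is approximated by functions with
  finite range.\<close>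

lemma borel_measurable_Caratheodory:
  fixes h :: "'a :: {metric_space, second_countable_topology} \<Rightarrow> 'w \<Rightarrow> real"
  assumes meas: "\<And>x. h x \<in> borel_measurable M"
    and cont: "\<And>w. w \<in> space M \<Longrightarrow> continuous_on UNIV (\<lambda>x. h x w)"
  shows "(\<lambda>(x, w). h x w) \<in> borel_measurable (borel \<Otimes>\<^sub>M M)"
proof -
  obtain S :: "nat \<Rightarrow> 'a \<Rightarrow> 'a" where S: "\<And>i. simple_function borel (S i)"
      "\<And>x. (\<lambda>i. S i x) \<longlonglongrightarrow> x"
    using borel_measurable_implies_sequence_metric[of "\<lambda>x::'a. x" borel undefined] by auto
  have "(\<lambda>p. h (fst p) (snd p)) \<in> borel_measurable (borel \<Otimes>\<^sub>M M)"
  proof (rule borel_measurable_LIMSEQ_real)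
    fix i
    have fin: "finite (range (S i))" using S(1)[of i] by (simp add: simple_function_def)
    have "S i \<in> measurable borel (count_space UNIV)"
      by (rule measurable_simple_function[OF S(1)])
    then have "S i -` {v} \<inter> space borel \<in> sets borel" for v
      by (rule measurable_sets) simp
    \<comment> \<open>Composition over a discrete first variable requires a countable index set, so
      the target is cut down from the whole type to the finite range.\<close>
    then have "S i \<in> measurable borel (count_space (range (S i)))"
      unfolding measurable_count_space_eq2[OF fin] by simp
    then have "(\<lambda>p. S i (fst p)) \<in> measurable (borel \<Otimes>\<^sub>M M) (count_space (range (S i)))"
      by (rule measurable_compose[OF measurable_fst])
    then show "(\<lambda>p. h (S i (fst p)) (snd p)) \<in> borel_measurable (borel \<Otimes>\<^sub>M M)"
      by (rule measurable_compose_countable'[where f = "\<lambda>v p. h v (snd p)",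
            OF measurable_compose[OF measurable_snd meas] _ countable_finite[OF fin]])
  next
    fix p assume "p \<in> space (borel \<Otimes>\<^sub>M M :: ('a \<times> 'w) measure)"
    then have "continuous (at (fst p)) (\<lambda>x. h x (snd p))"
      using cont[of "snd p"] by (auto simp: space_pair_measure continuous_on_eq_continuous_at)
    then show "(\<lambda>i. h (S i (fst p)) (snd p)) \<longlonglongrightarrow> h (fst p) (snd p)"
      using S(2)[of "fst p"] by (rule isCont_tendsto_compose)
  qed
  then show ?thesis by (simp add: case_prod_beta')
qed

text \<open>Presents each component of the gradient as a limit along a sequence, the form in which
  measurability passes from a function to its gradient.\<close>

lemma grad_difference_quotient:
  fixes h :: "real ^ 'd \<Rightarrow> real"
  assumes "h differentiable (at x)"
  shows "(\<lambda>i. real (Suc i) * (h (x + (1 / real (Suc i)) *\<^sub>R b) - h x)) \<longlonglongrightarrow> grad h x \<bullet> b"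
proof -
  have h: "(h has_derivative (\<lambda>z. z \<bullet> grad h x)) (at (x + 0 *\<^sub>R b))"
    using grad_works[OF assms] by (simp add: gderiv_def)
  have "((\<lambda>t. h (x + t *\<^sub>R b)) has_derivative (\<lambda>r. (r *\<^sub>R b) \<bullet> grad h x)) (at 0)"
    by (rule has_derivative_compose[of "\<lambda>t. x + t *\<^sub>R b" "\<lambda>r. r *\<^sub>R b" 0 UNIV h, OF _ h])
      (auto intro!: derivative_eq_intros)
  then have "((\<lambda>t. h (x + t *\<^sub>R b)) has_real_derivative (b \<bullet> grad h x)) (at 0)"
    by (simp add: has_field_derivative_def mult_commute_abs)
  then have "((\<lambda>t. (h (x + t *\<^sub>R b) - h x) / t) \<longlongrightarrow> b \<bullet> grad h x) (at 0)"
    by (simp add: DERIV_def)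
  moreover have "filterlim (\<lambda>i. 1 / real (Suc i)) (at 0) sequentially"
    using LIMSEQ_inverse_real_of_nat by (simp add: filterlim_at inverse_eq_divide)
  ultimately have "(\<lambda>i. (h (x + (1 / real (Suc i)) *\<^sub>R b) - h x) / (1 / real (Suc i))) \<longlonglongrightarrow> b \<bullet> grad h x"
    by (rule filterlim_compose)
  then show ?thesis by (simp add: inner_commute mult.commute)
qed

text \<open>Joint measurability matters because gradients are evaluated at random iterates. The
  gradient of a single loss may be discontinuous in \<open>x\<close>, so the Caratheodory argument
  is applied to the loss itself and the gradient is reached through difference quotients.\<close>

lemma borel_measurable_stoch_grad:
  fixes f :: "nat \<Rightarrow> real ^ 'd \<Rightarrow> 'w \<Rightarrow> real"
  assumes meas: "\<And>x. f m x \<in> borel_measurable M"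
    and diff: "\<And>w x. w \<in> space M \<Longrightarrow> (\<lambda>y. f m y w) differentiable (at x)"
  shows "(\<lambda>(x, w). stoch_grad f m x w) \<in> borel_measurable (borel \<Otimes>\<^sub>M M)"
proof -
  have J: "(\<lambda>p. f m (fst p) (snd p)) \<in> borel_measurable (borel \<Otimes>\<^sub>M M)"
    using borel_measurable_Caratheodory[of "f m" M] meas diff
    by (auto simp: case_prod_beta' continuous_on_eq_continuous_at
        intro: differentiable_imp_continuous_within)
  have "(\<lambda>p. stoch_grad f m (fst p) (snd p) \<bullet> b) \<in> borel_measurable (borel \<Otimes>\<^sub>M M)" for b
  proof (rule borel_measurable_LIMSEQ_real)
    fix i :: nat
    have "(\<lambda>p. (fst p + (1 / real (Suc i)) *\<^sub>R b, snd p)) \<in>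
        measurable (borel \<Otimes>\<^sub>M M) (borel \<Otimes>\<^sub>M M)"
      by measurable
    from measurable_compose[OF this J]
    have "(\<lambda>p. f m (fst p + (1 / real (Suc i)) *\<^sub>R b) (snd p)) \<in> borel_measurable (borel \<Otimes>\<^sub>M M)"
      by simp
    then show "(\<lambda>p. real (Suc i) * (f m (fst p + (1 / real (Suc i)) *\<^sub>R b) (snd p)
        - f m (fst p) (snd p))) \<in> borel_measurable (borel \<Otimes>\<^sub>M M)"
      using J by (intro borel_measurable_times borel_measurable_diff) auto
  next
    fix p :: "(real ^ 'd) \<times> 'w" assume "p \<in> space (borel \<Otimes>\<^sub>M M)"
    then show "(\<lambda>i. real (Suc i) * (f m (fst p + (1 / real (Suc i)) *\<^sub>R b) (snd p) - f m (fst p) (snd p)))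
        \<longlonglongrightarrow> stoch_grad f m (fst p) (snd p) \<bullet> b"
      using grad_difference_quotient[OF diff] by (auto simp: space_pair_measure stoch_grad_def)
  qed
  then show ?thesis
    by (simp add: case_prod_beta' borel_measurable_euclidean_space[of "\<lambda>p. stoch_grad f m (fst p) (snd p)"])
qed

subsection \<open>The quantizer\<close>

text \<open>The level is at most \<open>s - 1\<close>, so \<open>quant_zeta\<close> stays between 0
  and \<open>s\<close> for every value of the seed.\<close>

lemma abs_quantize_le:
  assumes "s \<ge> 1"
  shows "\<bar>quantize s u v $ i\<bar> \<le> norm v"
proof (cases "v = 0")
  case False
  define r where "r = \<bar>v $ i\<bar> / norm v"
  have r: "0 \<le> r" "r \<le> 1"
    using False component_le_norm_cart[of v i] by (auto simp: r_def)
  have z: "0 \<le> quant_zeta s r (u i)" "quant_zeta s r (u i) \<le> real s"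
    using quant_level_works(1)[OF assms r] by (auto simp: quant_zeta_def)
  have "\<bar>quantize s u v $ i\<bar> = norm v * \<bar>sgn (v $ i)\<bar> * (quant_zeta s r (u i) / real s)"
    using False z by (simp add: quantize_def r_def abs_mult)
  also have "\<dots> \<le> norm v * 1 * 1"
    using z assms by (intro mult_mono) (auto simp: sgn_real_def)
  finally show ?thesis by simp
qed (simp add: quantize_def)

lemma norm_quantize_le:
  fixes v :: "real ^ 'd"
  assumes "s \<ge> 1"
  shows "norm (quantize s u v) \<le> real CARD('d) * norm v"
proof -
  have "norm (quantize s u v) \<le> (\<Sum>i\<in>UNIV. \<bar>quantize s u v $ i\<bar>)" by (rule norm_le_l1_cart)
  also have "\<dots> \<le> (\<Sum>i\<in>(UNIV :: 'd set). norm v)" by (intro sum_mono abs_quantize_le assms)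
  finally show ?thesis by simp
qed

text \<open>No case distinction survives: at \<open>v = 0\<close> the factor \<open>norm v\<close>
  vanishes, whatever the ratio is.\<close>

lemma quantize_component:
  "quantize s u v $ i = norm v * sgn (v $ i) * quant_zeta s (\<bar>v $ i\<bar> / norm v) (u i) / real s"
  by (simp add: quantize_def)

lemma quantize_component_zero: "v $ i = 0 \<Longrightarrow> quantize s u v $ i = 0"
  by (simp add: quantize_component)

lemma measurable_quant_zeta [measurable]:
  "(\<lambda>(r, t). quant_zeta s r t) \<in> borel_measurable (borel \<Otimes>\<^sub>M borel)"
proof -
  have [measurable]: "quant_level s \<in> measurable borel (count_space UNIV)"
    unfolding quant_level_def by measurable
  show ?thesis unfolding quant_zeta_def by measurable
qed

text \<open>For fixed \<open>r\<close> the level is a constant, and rounding up is the indicator of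
  \<open>{..<p}\<close>, whose probability is the fractional part \<open>p\<close>. This is the
  source of all unbiasedness of the quantizer.\<close>

lemma integral_quant_zeta:
  assumes "s \<ge> 1" "0 \<le> r" "r \<le> 1"
  shows "(\<integral>t. quant_zeta s r t \<partial>uniform_measure lborel {0..1}) = r * real s"
proof -
  let ?U = "uniform_measure lborel {0..1::real}"
  define l where "l = real (quant_level s r)"
  define p where "p = r * real s - l"
  interpret U: prob_space ?U by (rule prob_space_uniform_measure) auto
  have eq: "quant_zeta s r t = l + indicator {..<p} t" for t
    by (simp add: quant_zeta_def p_def l_def indicator_def)
  have "{t. quant_zeta s r t = l + 1} = {..<p}"
    by (auto simp: eq indicator_def)
  then have m: "measure ?U {..<p} = p"
    using prob_quant_zeta[OF assms] by (simp add: l_def p_def)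
  have "(\<integral>t. quant_zeta s r t \<partial>?U) = l + measure ?U {..<p}"
    unfolding eq
    by (subst Bochner_Integration.integral_add)
      (use U.prob_space in \<open>simp_all add: less_top[symmetric] del: measure_uniform_measure emeasure_uniform_measure\<close>)
  then show ?thesis using m by (simp add: p_def)
qed

subsection \<open>Independence of past and fresh draws\<close>

text \<open>Independence is taken as a product formula for preimages, which fits variables of
  different types; rectangles then determine the joint law.\<close>

lemma (in prob_space) distr_pair_indep:
  assumes [measurable]: "X \<in> measurable M A" "Y \<in> measurable M B"
    and ind: "\<And>a b. a \<in> sets A \<Longrightarrow> b \<in> sets B \<Longrightarrow>
      prob ((X -` a \<inter> space M) \<inter> (Y -` b \<inter> space M)) = prob (X -` a \<inter> space M) * prob (Y -` b \<inter> space M)"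
  shows "distr M A X \<Otimes>\<^sub>M distr M B Y = distr M (A \<Otimes>\<^sub>M B) (\<lambda>\<omega>. (X \<omega>, Y \<omega>))"
proof (rule pair_measure_eqI)
  show "sigma_finite_measure (distr M A X)" "sigma_finite_measure (distr M B Y)"
    by (intro prob_space_imp_sigma_finite prob_space_distr; simp)+
next
  fix a b assume "a \<in> sets (distr M A X)" "b \<in> sets (distr M B Y)"
  then have [measurable]: "a \<in> sets A" "b \<in> sets B" by auto
  have "(\<lambda>\<omega>. (X \<omega>, Y \<omega>)) -` (a \<times> b) \<inter> space M = (X -` a \<inter> space M) \<inter> (Y -` b \<inter> space M)"
    by auto
  then show "emeasure (distr M A X) a * emeasure (distr M B Y) b =
      emeasure (distr M (A \<Otimes>\<^sub>M B) (\<lambda>\<omega>. (X \<omega>, Y \<omega>))) (a \<times> b)"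
    by (simp add: emeasure_distr emeasure_eq_measure ind ennreal_mult)
qed (simp cong: sets_pair_measure_cong)

text \<open>Stands in for a vanishing conditional expectation: with \<open>X\<close> the known part
  and \<open>Y\<close> the fresh draw, Fubini integrates \<open>Y\<close> out first.\<close>

lemma (in prob_space) integral_indep_zero:
  fixes \<phi> :: "'x \<times> 'y \<Rightarrow> real"
  assumes [measurable]: "X \<in> measurable M A" "Y \<in> measurable M B"
    and d: "distr M A X \<Otimes>\<^sub>M distr M B Y = distr M (A \<Otimes>\<^sub>M B) (\<lambda>\<omega>. (X \<omega>, Y \<omega>))"
    and [measurable]: "\<phi> \<in> borel_measurable (A \<Otimes>\<^sub>M B)"
    and int: "integrable M (\<lambda>\<omega>. \<phi> (X \<omega>, Y \<omega>))"
    and zero: "\<And>x. x \<in> space A \<Longrightarrow> (\<integral>y. \<phi> (x, y) \<partial>distr M B Y) = 0"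
  shows "(\<integral>\<omega>. \<phi> (X \<omega>, Y \<omega>) \<partial>M) = 0"
proof -
  interpret X: prob_space "distr M A X" by (rule prob_space_distr) simp
  interpret Y: prob_space "distr M B Y" by (rule prob_space_distr) simp
  interpret XY: pair_sigma_finite "distr M A X" "distr M B Y" ..
  have i: "integrable (distr M A X \<Otimes>\<^sub>M distr M B Y) \<phi>"
    unfolding d using int by (subst integrable_distr_eq) simp_all
  have "(\<integral>\<omega>. \<phi> (X \<omega>, Y \<omega>) \<partial>M) = (\<integral>z. \<phi> z \<partial>(distr M A X \<Otimes>\<^sub>M distr M B Y))"
    unfolding d by (subst integral_distr) simp_all
  also have "\<dots> = (\<integral>x. (\<integral>y. \<phi> (x, y) \<partial>distr M B Y) \<partial>distr M A X)"
    by (rule XY.integral_fst'[OF i, symmetric])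
  also have "\<dots> = (\<integral>x. 0 \<partial>distr M A X)"
    by (rule Bochner_Integration.integral_cong) (auto simp: zero)
  finally show ?thesis by simp
qed

text \<open>The Tonelli counterpart, which can be applied before any integrability is known and is
  used to establish it.\<close>

lemma (in prob_space) nn_integral_indep_le:
  fixes \<phi> :: "'x \<times> 'y \<Rightarrow> ennreal"
  assumes [measurable]: "X \<in> measurable M A" "Y \<in> measurable M B"
    and d: "distr M A X \<Otimes>\<^sub>M distr M B Y = distr M (A \<Otimes>\<^sub>M B) (\<lambda>\<omega>. (X \<omega>, Y \<omega>))"
    and [measurable]: "\<phi> \<in> borel_measurable (A \<Otimes>\<^sub>M B)"
    and le: "\<And>x. x \<in> space A \<Longrightarrow> (\<integral>\<^sup>+y. \<phi> (x, y) \<partial>distr M B Y) \<le> b"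
  shows "(\<integral>\<^sup>+\<omega>. \<phi> (X \<omega>, Y \<omega>) \<partial>M) \<le> b"
proof -
  interpret X: prob_space "distr M A X" by (rule prob_space_distr) simp
  interpret Y: prob_space "distr M B Y" by (rule prob_space_distr) simp
  have "(\<integral>\<^sup>+\<omega>. \<phi> (X \<omega>, Y \<omega>) \<partial>M) = (\<integral>\<^sup>+z. \<phi> z \<partial>(distr M A X \<Otimes>\<^sub>M distr M B Y))"
    unfolding d by (subst nn_integral_distr) simp_all
  also have "\<dots> = (\<integral>\<^sup>+x. (\<integral>\<^sup>+y. \<phi> (x, y) \<partial>distr M B Y) \<partial>distr M A X)"
    by (rule Y.nn_integral_fst[symmetric]) simp
  also have "\<dots> \<le> (\<integral>\<^sup>+x. b \<partial>distr M A X)"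
    by (rule nn_integral_mono) (auto simp: le)
  also have "\<dots> = b" using X.emeasure_space_1 by simp
  finally show ?thesis .
qed

text \<open>The pi-system property under which independent families may be regrouped into generated
  sigma-algebras.\<close>

lemma Int_stable_draw_events: "Int_stable (draw_events P D \<xi> u e)"
proof (cases e)
  case (Sample n k m)
  show ?thesis
    unfolding Int_stable_def Sample draw_events.simps
  proof clarify
    fix A B assume "A \<in> sets (D m)" "B \<in> sets (D m)"
    then show "\<exists>C. (\<xi> n k m -` A \<inter> space P) \<inter> (\<xi> n k m -` B \<inter> space P) = \<xi> n k m -` C \<inter> space P \<and> C \<in> sets (D m)"
      by (intro exI[of _ "A \<inter> B"]) auto
  qed
next
  case (Seed n j t i)
  show ?thesis
    unfolding Int_stable_def Seed draw_events.simps
  proof clarify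
    fix A B :: "real set" assume "A \<in> sets borel" "B \<in> sets borel"
    then show "\<exists>C. (u n j t i -` A \<inter> space P) \<inter> (u n j t i -` B \<inter> space P) = u n j t i -` C \<inter> space P \<and> C \<in> sets borel"
      by (intro exI[of _ "A \<inter> B"]) auto
  qed
qed

lemma draw_events_subset: "draw_events P D \<xi> u e \<subseteq> Pow (space P)"
  by (cases e) auto

section \<open>A single run with constant stepsize\<close>

locale ar_run = prob_space P for P :: "'p measure" +
  fixes N M K s :: nat
    and D :: "nat \<Rightarrow> 'w measure"
    and f :: "nat \<Rightarrow> real ^ ('d :: {finite, linorder}) \<Rightarrow> 'w \<Rightarrow> real"
    and c L \<sigma> \<kappa> :: real
    and x1 :: "real ^ ('d :: {finite, linorder})"
    and \<xi> :: "nat \<Rightarrow> nat \<Rightarrow> nat \<Rightarrow> 'p \<Rightarrow> 'w"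
    and u :: "nat \<Rightarrow> nat \<Rightarrow> nat \<Rightarrow> 'd :: {finite, linorder} \<Rightarrow> 'p \<Rightarrow> real"
  assumes M: "M \<ge> 1" and M_dvd: "M dvd CARD('d :: {finite, linorder})" and s: "s \<ge> 1" and L: "L > 0" and c: "c > 0"
    and problem: "stochastic_problem M D f"
    and smooth: "smooth_workers M D f L"
    and variance: "bounded_variance M D f \<sigma> \<kappa>"
    and randomness: "algorithm_randomness N M K D P \<xi> u"
begin

abbreviation "gF \<equiv> grad (objective M D f)"
abbreviation "gFw m \<equiv> grad (worker_obj D f m)"
abbreviation "G m \<equiv> stoch_grad f m"

lemma worker_lipschitz: "m < M \<Longrightarrow> L-lipschitz_on UNIV (gFw m)"
  using smooth by (simp add: smooth_workers_def)

lemma norm_worker_diff: "m < M \<Longrightarrow> norm (gFw m x - gFw m y) \<le> L * norm (x - y)"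
  using lipschitz_onD[OF worker_lipschitz, of m x y] by (simp add: dist_norm)

lemma objective_GDERIV: "GDERIV (objective M D f) x :> (1 / real M) *\<^sub>R (\<Sum>m<M. gFw m x)"
proof -
  have "(worker_obj D f m has_derivative (\<lambda>z. z \<bullet> gFw m x)) (at x)" if "m < M" for m
    using smooth that grad_works by (auto simp: smooth_workers_def gderiv_def)
  then have "((\<lambda>x. (1 / real M) * (\<Sum>m<M. worker_obj D f m x)) has_derivative
      (\<lambda>z. (1 / real M) * (\<Sum>m<M. z \<bullet> gFw m x))) (at x)"
    by (intro has_derivative_mult_right has_derivative_sum) auto
  moreover have "objective M D f = (\<lambda>x. (1 / real M) * (\<Sum>m<M. worker_obj D f m x))"
    by (simp add: fun_eq_iff objective_def)
  ultimately show ?thesis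
    unfolding gderiv_def by (simp add: inner_sum_right)
qed

lemma objective_grad: "gF x = (1 / real M) *\<^sub>R (\<Sum>m<M. gFw m x)"
  by (rule grad_eqI[OF objective_GDERIV])

lemma objective_differentiable: "objective M D f differentiable (at x)"
  using objective_GDERIV by (auto simp: gderiv_def differentiable_def)

lemma objective_lipschitz: "L-lipschitz_on UNIV gF"
proof (rule lipschitz_onI)
  fix x y
  have "dist (gF x) (gF y) = (1 / real M) * norm (\<Sum>m<M. gFw m x - gFw m y)"
    by (simp add: dist_norm objective_grad sum_subtractf flip: scaleR_diff_right)
  also have "\<dots> \<le> (1 / real M) * (\<Sum>m<M. L * norm (x - y))"
    by (intro mult_left_mono order_trans[OF norm_sum] sum_mono norm_worker_diff) auto
  also have "\<dots> = L * dist x y"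
    using M by (simp add: dist_norm)
  finally show "dist (gF x) (gF y) \<le> L * dist x y" .
qed (use L in simp)

lemma measurable_worker_grad [measurable]: "m < M \<Longrightarrow> gFw m \<in> borel_measurable borel"
  using lipschitz_on_continuous_on[OF worker_lipschitz] by (rule borel_measurable_continuous_onI)

lemma measurable_objective [measurable]: "objective M D f \<in> borel_measurable borel"
  by (intro borel_measurable_continuous_onI)
    (auto simp: continuous_on_eq_continuous_at objective_differentiable
      intro: differentiable_imp_continuous_within)

lemma measurable_stoch_grad [measurable]:
  assumes "m < M"
  shows "(\<lambda>p. G m (fst p) (snd p)) \<in> borel_measurable (borel \<Otimes>\<^sub>M D m)"
  using borel_measurable_stoch_grad[of f m "D m"] problem assms
  by (auto simp: stochastic_problem_def case_prod_beta' dest: borel_measurable_integrable)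

section \<open>Sigma-algebras generated by sets of draws\<close>

definition draws :: "'d draw set" where
  "draws = {Sample n k m |n k m. n < N \<and> k < K \<and> m < M} \<union>
     {Seed n j t i |n j t i. n < N \<and> j < M \<and> t < M \<and> i \<in> segment M j}"

text \<open>A measure serves merely as a carrier of a sigma-algebra here; probabilities are always
  taken in \<open>P\<close>. Indexing by sets of draws rather than by time turns freshness of a draw
  into non-membership.\<close>

definition H :: "'d draw set \<Rightarrow> 'p measure" where
  "H I = sigma (space P) (\<Union>e\<in>I. draw_events P D \<xi> u e)"

lemma indep_draws: "indep_sets (draw_events P D \<xi> u) draws"
  using randomness by (simp add: algorithm_randomness_def draws_def)

lemma space_H [simp]: "space (H I) = space P"
  by (simp add: H_def space_measure_of_conv)

lemma sets_H: "sets (H I) = sigma_sets (space P) (\<Union>e\<in>I. draw_events P D \<xi> u e)"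
  unfolding H_def using draw_events_subset by (intro sets_measure_of) blast

lemma sets_H_subset: "I \<subseteq> draws \<Longrightarrow> sets (H I) \<subseteq> events"
  unfolding sets_H using indep_draws by (intro sets.sigma_sets_subset) (auto simp: indep_sets_def)

lemma measurable_H_mono: "X \<in> measurable (H I) A \<Longrightarrow> I \<subseteq> J \<Longrightarrow> X \<in> measurable (H J) A"
  using sigma_sets_mono'[of "\<Union>e\<in>I. draw_events P D \<xi> u e" "\<Union>e\<in>J. draw_events P D \<xi> u e" "space P"]
  by (auto simp: measurable_def sets_H)

lemma measurable_H_P: "X \<in> measurable (H I) A \<Longrightarrow> I \<subseteq> draws \<Longrightarrow> X \<in> measurable P A"
  using sets_H_subset[of I] by (auto simp: measurable_def)

lemma measurable_sample:
  assumes "Sample n k m \<in> I" "n < N" "k < K" "m < M"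
  shows "\<xi> n k m \<in> measurable (H I) (D m)"
proof (rule measurableI)
  show "\<xi> n k m \<omega> \<in> space (D m)" if "\<omega> \<in> space (H I)" for \<omega>
    using randomness assms that by (auto simp: algorithm_randomness_def dest: measurable_space)
  show "\<xi> n k m -` A \<inter> space (H I) \<in> sets (H I)" if "A \<in> sets (D m)" for A
    using that assms(1) unfolding sets_H by (intro sigma_sets.Basic) (force intro: bexI[rotated])
qed

lemma measurable_seed:
  assumes "Seed n j t i \<in> I"
  shows "u n j t i \<in> borel_measurable (H I)"
proof (rule measurableI)
  show "u n j t i -` A \<inter> space (H I) \<in> sets (H I)" if "A \<in> sets borel" for A
    using that assms(1) unfolding sets_H by (intro sigma_sets.Basic) (force intro: bexI[rotated])
qed simp

text \<open>The independent family is regrouped into two blocks, indexed by \<open>bool\<close>: the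
  known draws \<open>I\<close> and the single draw \<open>e\<close>.\<close>

lemma prob_fresh_draw:
  assumes "I \<subseteq> draws" "e \<in> draws" "e \<notin> I" "a \<in> sets (H I)" "b \<in> draw_events P D \<xi> u e"
  shows "prob (a \<inter> b) = prob a * prob b"
proof -
  define J where "J x = (if x then I else {e})" for x
  have "indep_sets (draw_events P D \<xi> u) (\<Union>x\<in>UNIV. J x)"
    using assms by (intro indep_sets_mono_index[OF _ indep_draws]) (auto simp: J_def)
  then have "indep_sets (\<lambda>x. sigma_sets (space P) (\<Union>e\<in>J x. draw_events P D \<xi> u e)) UNIV"
    using assms(3)
    by (intro indep_sets_collect_sigma Int_stable_draw_events) (auto simp: J_def disjoint_family_on_def)
  then have "prob (\<Inter>x\<in>UNIV. if x then a else b) = (\<Prod>x\<in>UNIV. prob (if x then a else b))"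
    using assms(4,5) by (intro indep_setsD) (auto simp: sets_H J_def)
  then show ?thesis by (simp add: UNIV_bool Int_commute mult.commute)
qed

lemma sample_law: "Sample n k m \<in> draws \<Longrightarrow> distr P (D m) (\<xi> n k m) = D m"
  using randomness by (auto simp: algorithm_randomness_def draws_def)

lemma seed_law:
  assumes "Seed n j t i \<in> draws"
  shows "distr P borel (u n j t i) = uniform_measure lborel {0..1}"
proof -
  have "distr P borel (u n j t i) = distr P lborel (u n j t i)"
    by (rule distr_cong) auto
  then show ?thesis
    using randomness assms by (auto simp: algorithm_randomness_def draws_def)
qed

text \<open>The target space of \<open>X\<close> is arbitrary, so several known quantities can be
  handled at once by pairing them.\<close>

lemma sample_prod:
  assumes I: "I \<subseteq> draws" "Sample n k m \<in> draws" "Sample n k m \<notin> I"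
    and X: "X \<in> measurable (H I) A"
  shows "distr P A X \<Otimes>\<^sub>M distr P (D m) (\<xi> n k m) = distr P (A \<Otimes>\<^sub>M D m) (\<lambda>\<omega>. (X \<omega>, \<xi> n k m \<omega>))"
proof (rule distr_pair_indep)
  have "\<xi> n k m \<in> measurable (H draws) (D m)"
    using I(2) by (intro measurable_sample) (auto simp: draws_def)
  then show "\<xi> n k m \<in> measurable P (D m)" by (rule measurable_H_P) simp
  show "prob ((X -` a \<inter> space P) \<inter> (\<xi> n k m -` b \<inter> space P)) = prob (X -` a \<inter> space P) * prob (\<xi> n k m -` b \<inter> space P)"
    if "a \<in> sets A" "b \<in> sets (D m)" for a b
    using that measurable_sets[OF X] by (intro prob_fresh_draw[OF I]) auto
qed (rule measurable_H_P[OF X I(1)])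

lemma seed_prod:
  assumes I: "I \<subseteq> draws" "Seed n j t i \<in> draws" "Seed n j t i \<notin> I"
    and X: "X \<in> measurable (H I) A"
  shows "distr P A X \<Otimes>\<^sub>M distr P borel (u n j t i) = distr P (A \<Otimes>\<^sub>M borel) (\<lambda>\<omega>. (X \<omega>, u n j t i \<omega>))"
proof (rule distr_pair_indep)
  show "u n j t i \<in> borel_measurable P"
    using I(2) by (intro measurable_H_P[OF measurable_seed]) auto
  show "prob ((X -` a \<inter> space P) \<inter> (u n j t i -` b \<inter> space P)) = prob (X -` a \<inter> space P) * prob (u n j t i -` b \<inter> space P)"
    if "a \<in> sets A" "b \<in> sets borel" for a b
    using that measurable_sets[OF X] by (intro prob_fresh_draw[OF I]) auto
qed (rule measurable_H_P[OF X I(1)])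

subsection \<open>Square-integrable functions of the past\<close>

text \<open>Adaptedness and square integrability in one predicate. The inclusion in
  \<open>draws\<close> makes \<open>H I\<close> a sub-sigma-algebra of \<open>P\<close>, so
  membership yields measurability in \<open>P\<close> as well.\<close>

definition L2 :: "'d draw set \<Rightarrow> ('p \<Rightarrow> (real, 'd) vec) \<Rightarrow> bool" where
  "L2 I X \<longleftrightarrow> I \<subseteq> draws \<and> X \<in> borel_measurable (H I) \<and> integrable P (\<lambda>\<omega>. (norm (X \<omega>))\<^sup>2)"

lemma L2_measurable_H: "L2 I X \<Longrightarrow> X \<in> borel_measurable (H I)"
  and L2_measurable: "L2 I X \<Longrightarrow> X \<in> borel_measurable P"
  and L2_integrable: "L2 I X \<Longrightarrow> integrable P (\<lambda>\<omega>. (norm (X \<omega>))\<^sup>2)"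
  and L2_subset: "L2 I X \<Longrightarrow> I \<subseteq> draws"
  using measurable_H_P by (auto simp: L2_def)

lemma L2_mono: "L2 I X \<Longrightarrow> I \<subseteq> J \<Longrightarrow> J \<subseteq> draws \<Longrightarrow> L2 J X"
  by (auto simp: L2_def intro: measurable_H_mono)

lemma L2_bound:
  assumes "I \<subseteq> draws" "X \<in> borel_measurable (H I)" "integrable P B" "\<And>\<omega>. \<omega> \<in> space P \<Longrightarrow> (norm (X \<omega>))\<^sup>2 \<le> B \<omega>"
  shows "L2 I X"
proof -
  have [measurable]: "X \<in> borel_measurable P" using assms by (auto intro: measurable_H_P)
  have "integrable P (\<lambda>\<omega>. (norm (X \<omega>))\<^sup>2)"
    by (rule Bochner_Integration.integrable_bound[OF assms(3)]) (auto intro!: AE_I2 order_trans[OF assms(4)])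
  then show ?thesis using assms by (simp add: L2_def)
qed

lemma L2_const: "I \<subseteq> draws \<Longrightarrow> L2 I (\<lambda>_. v)"
  by (simp add: L2_def)

lemma L2_add:
  assumes "L2 I X" "L2 I Y"
  shows "L2 I (\<lambda>\<omega>. X \<omega> + Y \<omega>)"
proof (rule L2_bound)
  show "integrable P (\<lambda>\<omega>. 2 * (norm (X \<omega>))\<^sup>2 + 2 * (norm (Y \<omega>))\<^sup>2)"
    using assms by (auto simp: L2_integrable)
  show "(\<lambda>\<omega>. X \<omega> + Y \<omega>) \<in> borel_measurable (H I)"
    using assms by (intro borel_measurable_add L2_measurable_H)
qed (use assms in \<open>auto simp: norm_add_power2_le intro: L2_subset[THEN subsetD]\<close>)

lemma L2_scale: "L2 I X \<Longrightarrow> L2 I (\<lambda>\<omega>. a *\<^sub>R X \<omega>)"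
  by (auto simp: L2_def power_mult_distrib)

lemma L2_diff: "L2 I X \<Longrightarrow> L2 I Y \<Longrightarrow> L2 I (\<lambda>\<omega>. X \<omega> - Y \<omega>)"
  using L2_add[of I X "\<lambda>\<omega>. (- 1) *\<^sub>R Y \<omega>"] L2_scale[of I Y "- 1"] by simp

lemma L2_sum: "finite A \<Longrightarrow> I \<subseteq> draws \<Longrightarrow> (\<And>a. a \<in> A \<Longrightarrow> L2 I (X a)) \<Longrightarrow> L2 I (\<lambda>\<omega>. \<Sum>a\<in>A. X a \<omega>)"
  by (induction A rule: finite_induct) (auto simp: L2_const L2_add)

lemma L2_lipschitz:
  assumes "L2 I X" and lip: "L-lipschitz_on UNIV h"
  shows "L2 I (\<lambda>\<omega>. h (X \<omega>))"
proof -
  have h: "h \<in> borel_measurable borel"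
    using lipschitz_on_continuous_on[OF lip] by (rule borel_measurable_continuous_onI)
  have d: "L2 I (\<lambda>\<omega>. h (X \<omega>) - h 0)"
  proof (rule L2_bound)
    show "integrable P (\<lambda>\<omega>. L\<^sup>2 * (norm (X \<omega>))\<^sup>2)"
      using assms by (auto simp: L2_integrable)
    show "(norm (h (X \<omega>) - h 0))\<^sup>2 \<le> L\<^sup>2 * (norm (X \<omega>))\<^sup>2" for \<omega>
      using lipschitz_onD[OF lip, of "X \<omega>" 0]
      by (simp add: dist_norm power_mono flip: power_mult_distrib)
    show "I \<subseteq> draws" using assms(1) by (rule L2_subset)
    show "(\<lambda>\<omega>. h (X \<omega>) - h 0) \<in> borel_measurable (H I)"
      using measurable_compose[OF L2_measurable_H[OF assms(1)] h] by simp
  qed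
  show ?thesis
    using L2_add[OF d L2_const[OF L2_subset[OF d], of "h 0"]] by simp
qed

lemma integrable_inner_L2:
  assumes "L2 I X" "L2 J Y"
  shows "integrable P (\<lambda>\<omega>. X \<omega> \<bullet> Y \<omega>)"
proof (rule Bochner_Integration.integrable_bound)
  have [measurable]: "X \<in> borel_measurable P" "Y \<in> borel_measurable P"
    using assms by (auto intro: L2_measurable)
  show "integrable P (\<lambda>\<omega>. (norm (X \<omega>))\<^sup>2 + (norm (Y \<omega>))\<^sup>2)"
    using assms by (auto simp: L2_integrable)
  show "(\<lambda>\<omega>. X \<omega> \<bullet> Y \<omega>) \<in> borel_measurable P" by measurable
  show "AE \<omega> in P. norm (X \<omega> \<bullet> Y \<omega>) \<le> norm ((norm (X \<omega>))\<^sup>2 + (norm (Y \<omega>))\<^sup>2)"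
    by (intro AE_I2) (auto intro: order_trans[OF abs_inner_le_power2])
qed

text \<open>A Lipschitz gradient allows at most quadratic growth around 0, in both
  directions.\<close>

lemma integrable_objective:
  assumes "L2 I X"
  shows "integrable P (\<lambda>\<omega>. objective M D f (X \<omega>))"
proof (rule Bochner_Integration.integrable_bound)
  have [measurable]: "X \<in> borel_measurable P"
    using assms by (rule L2_measurable)
  let ?B = "\<lambda>\<omega>. \<bar>objective M D f 0\<bar> + ((norm (gF 0))\<^sup>2 + (norm (X \<omega>))\<^sup>2) + L * (norm (X \<omega>))\<^sup>2"
  show "integrable P ?B"
    using assms by (auto simp: L2_integrable)
  show "(\<lambda>\<omega>. objective M D f (X \<omega>)) \<in> borel_measurable P" by measurable
  show "AE \<omega> in P. norm (objective M D f (X \<omega>)) \<le> norm (?B \<omega>)"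
  proof (rule AE_I2)
    fix \<omega>
    have "\<bar>objective M D f (X \<omega>)\<bar> \<le> ?B \<omega>"
      using mean_value_gradient[OF objective_differentiable objective_lipschitz, of "X \<omega>" 0]
        abs_inner_le_power2[of "gF 0" "X \<omega>"] by simp
    then show "norm (objective M D f (X \<omega>)) \<le> norm (?B \<omega>)" by simp
  qed
qed

text \<open>The variance bound holds uniformly in the query point, so \<open>X\<close> has to be
  measurable only. Tonelli turns that bound into square integrability of the noise; Fubini, with
  integrability now available, gives orthogonality to everything known.\<close>

lemma noise_moments:
  assumes I: "I \<subseteq> draws" "Sample n k m \<in> draws" "Sample n k m \<notin> I"
    and X: "X \<in> borel_measurable (H I)"
  defines "\<eta> \<equiv> \<lambda>\<omega>. G m (X \<omega>) (\<xi> n k m \<omega>) - gFw m (X \<omega>)"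
  shows "L2 (insert (Sample n k m) I) \<eta>" "expectation (\<lambda>\<omega>. (norm (\<eta> \<omega>))\<^sup>2) \<le> \<sigma>\<^sup>2"
    "L2 I Z \<Longrightarrow> expectation (\<lambda>\<omega>. Z \<omega> \<bullet> \<eta> \<omega>) = 0"
proof -
  have m: "m < M" "n < N" "k < K" using I(2) by (auto simp: draws_def)
  note [measurable] = measurable_stoch_grad[OF m(1)] measurable_worker_grad[OF m(1)]
  define J where "J = insert (Sample n k m) I"
  have J: "J \<subseteq> draws" "I \<subseteq> J" using I by (auto simp: J_def)
  have \<xi>J: "\<xi> n k m \<in> measurable (H J) (D m)"
    using m by (intro measurable_sample) (auto simp: J_def)
  have XJ: "X \<in> borel_measurable (H J)" using X J(2) by (rule measurable_H_mono)
  have "(\<lambda>\<omega>. (X \<omega>, \<xi> n k m \<omega>)) \<in> measurable (H J) (borel \<Otimes>\<^sub>M D m)"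
    using \<xi>J XJ by measurable
  from measurable_compose[OF this measurable_stoch_grad[OF m(1)]]
  have \<eta>J: "\<eta> \<in> borel_measurable (H J)"
    unfolding \<eta>_def using measurable_compose[OF XJ measurable_worker_grad[OF m(1)]]
    by (intro borel_measurable_diff) simp_all
  note [measurable] = measurable_H_P[OF X I(1)] measurable_H_P[OF \<xi>J J(1)] measurable_H_P[OF \<eta>J J(1)]
  have law: "distr P (D m) (\<xi> n k m) = D m" by (rule sample_law[OF I(2)])
  have var: "integrable (D m) (\<lambda>y. (norm (G m x y - gFw m x))\<^sup>2)"
      "(\<integral>y. (norm (G m x y - gFw m x))\<^sup>2 \<partial>D m) \<le> \<sigma>\<^sup>2" for x
    using variance m(1) by (auto simp: bounded_variance_def)
  have "(\<integral>\<^sup>+\<omega>. (\<lambda>(x, y). ennreal ((norm (G m x y - gFw m x))\<^sup>2)) (X \<omega>, \<xi> n k m \<omega>) \<partial>P) \<le> ennreal (\<sigma>\<^sup>2)"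
  proof (rule nn_integral_indep_le[OF _ _ sample_prod[OF I X]])
    fix x
    have "(\<integral>\<^sup>+y. ennreal ((norm (G m x y - gFw m x))\<^sup>2) \<partial>D m) = ennreal (\<integral>y. (norm (G m x y - gFw m x))\<^sup>2 \<partial>D m)"
      by (rule nn_integral_eq_integral[OF var(1)]) simp
    also have "\<dots> \<le> ennreal (\<sigma>\<^sup>2)" using var(2) by (rule ennreal_leI)
    finally show "(\<integral>\<^sup>+y. (\<lambda>(x, y). ennreal ((norm (G m x y - gFw m x))\<^sup>2)) (x, y) \<partial>distr P (D m) (\<xi> n k m)) \<le> ennreal (\<sigma>\<^sup>2)"
      by (simp add: law)
  qed (measurable, simp_all add: case_prod_beta' m)
  then have nn: "(\<integral>\<^sup>+\<omega>. ennreal ((norm (\<eta> \<omega>))\<^sup>2) \<partial>P) \<le> ennreal (\<sigma>\<^sup>2)"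
    by (simp add: \<eta>_def)
  have int: "integrable P (\<lambda>\<omega>. (norm (\<eta> \<omega>))\<^sup>2)"
    by (rule integrableI_bounded) (use nn in \<open>auto simp: less_top[symmetric] top_unique\<close>)
  show L2\<eta>: "L2 (insert (Sample n k m) I) \<eta>"
    using int \<eta>J J by (simp add: L2_def J_def)
  have "ennreal (expectation (\<lambda>\<omega>. (norm (\<eta> \<omega>))\<^sup>2)) \<le> ennreal (\<sigma>\<^sup>2)"
    using nn by (subst nn_integral_eq_integral[OF int, symmetric]) auto
  then show "expectation (\<lambda>\<omega>. (norm (\<eta> \<omega>))\<^sup>2) \<le> \<sigma>\<^sup>2"
    by (simp add: ennreal_le_iff)
  assume Z: "L2 I Z"
  \<comment> \<open>The integrand depends on the test vector and on the query point, so both form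
    the known part.\<close>
  have ZX: "(\<lambda>\<omega>. (Z \<omega>, X \<omega>)) \<in> measurable (H I) (borel \<Otimes>\<^sub>M borel)"
    using L2_measurable_H[OF Z] X by measurable
  have "expectation (\<lambda>\<omega>. (\<lambda>((z, x), y). z \<bullet> (G m x y - gFw m x)) ((Z \<omega>, X \<omega>), \<xi> n k m \<omega>)) = 0"
  proof (rule integral_indep_zero[OF _ _ sample_prod[OF I ZX]])
    show "(\<lambda>\<omega>. (Z \<omega>, X \<omega>)) \<in> measurable P (borel \<Otimes>\<^sub>M borel)"
      by (rule measurable_H_P[OF ZX I(1)])
    show "integrable P (\<lambda>\<omega>. (\<lambda>((z, x), y). z \<bullet> (G m x y - gFw m x)) ((Z \<omega>, X \<omega>), \<xi> n k m \<omega>))"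
      using integrable_inner_L2[OF Z L2\<eta>] by (simp add: \<eta>_def)
    have "(\<lambda>p. (snd (fst p), snd p)) \<in> measurable ((borel \<Otimes>\<^sub>M borel) \<Otimes>\<^sub>M D m) (borel \<Otimes>\<^sub>M D m)"
      by measurable
    note [measurable] = measurable_compose[OF this measurable_stoch_grad[OF m(1)], simplified]
    show "(\<lambda>((z, x), y). z \<bullet> (G m x y - gFw m x)) \<in> borel_measurable ((borel \<Otimes>\<^sub>M borel) \<Otimes>\<^sub>M D m)"
      unfolding case_prod_beta'
      by (intro borel_measurable_inner borel_measurable_diff
          measurable_compose[OF _ measurable_worker_grad[OF m(1)]]) measurable
    fix zx :: "(real, 'd) vec \<times> (real, 'd) vec"
    obtain z x where zx: "zx = (z, x)" by (cases zx)
    interpret D: prob_space "D m" using problem m(1) by (simp add: stochastic_problem_def)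
    have i: "integrable (D m) (G m x)" and e: "(\<integral>y. G m x y \<partial>D m) = gFw m x"
      using problem m(1) by (auto simp: stochastic_problem_def)
    have "(\<integral>y. z \<bullet> (G m x y - gFw m x) \<partial>D m) = z \<bullet> (\<integral>y. G m x y - gFw m x \<partial>D m)"
      using i by (intro integral_inner_right) auto
    also have "(\<integral>y. G m x y - gFw m x \<partial>D m) = 0"
      using i e by (subst Bochner_Integration.integral_diff) (auto simp: D.prob_space)
    finally show "(\<integral>y. (\<lambda>((z, x), y). z \<bullet> (G m x y - gFw m x)) (zx, y) \<partial>distr P (D m) (\<xi> n k m)) = 0"
      by (simp add: law zx)
  qed simp
  then show "expectation (\<lambda>\<omega>. Z \<omega> \<bullet> \<eta> \<omega>) = 0" by (simp add: \<eta>_def)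
qed

text \<open>Only the seeds of segment \<open>j\<close> are required in \<open>J\<close>. On the
  other coordinates \<open>V\<close> vanishes, and the quantizer keeps zeros.\<close>

lemma measurable_quantize_fresh:
  assumes V: "V \<in> borel_measurable (H J)" and supp: "\<And>\<omega> i. i \<notin> segment M j \<Longrightarrow> V \<omega> $ i = 0"
    and seeds: "\<And>i. i \<in> segment M j \<Longrightarrow> Seed n j t i \<in> J"
  shows "(\<lambda>\<omega>. quantize s (\<lambda>i. u n j t i \<omega>) (V \<omega>)) \<in> borel_measurable (H J)"
  unfolding borel_measurable_euclidean_space[of "\<lambda>\<omega>. quantize s (\<lambda>i. u n j t i \<omega>) (V \<omega>)"]
proof
  fix b :: "(real, 'd) vec" assume "b \<in> Basis"
  then obtain i where b: "b = axis i 1" by (auto simp: Basis_vec_def)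
  have "(\<lambda>\<omega>. quantize s (\<lambda>i. u n j t i \<omega>) (V \<omega>) $ i) \<in> borel_measurable (H J)"
  proof (cases "i \<in> segment M j")
    case True
    note [measurable] = V measurable_seed[OF seeds[OF True]]
    have [measurable]: "(\<lambda>\<omega>. V \<omega> $ i) \<in> borel_measurable (H J)"
      using borel_measurable_inner[OF V borel_measurable_const[of "axis i 1"]] by (simp add: inner_axis)
    show ?thesis unfolding quantize_component by measurable
  qed (simp add: quantize_component_zero supp)
  then show "(\<lambda>\<omega>. quantize s (\<lambda>i. u n j t i \<omega>) (V \<omega>) \<bullet> b) \<in> borel_measurable (H J)"
    by (simp add: b inner_axis)
qed

text \<open>The inner product is split into coordinates, so that each summand involves one scalar
  fresh seed, to which \<open>integral_quant_zeta\<close> applies.\<close>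

lemma quantize_fresh:
  assumes V: "L2 I V" and supp: "\<And>\<omega> i. i \<notin> segment M j \<Longrightarrow> V \<omega> $ i = 0"
    and J: "I \<subseteq> J" "J \<subseteq> draws" "\<And>i. i \<in> segment M j \<Longrightarrow> Seed n j t i \<in> J - I"
  defines "Q \<equiv> \<lambda>\<omega>. quantize s (\<lambda>i. u n j t i \<omega>) (V \<omega>)"
  shows "L2 J Q" "L2 I Z \<Longrightarrow> expectation (\<lambda>\<omega>. Z \<omega> \<bullet> (Q \<omega> - V \<omega>)) = 0"
proof -
  have QJ: "Q \<in> borel_measurable (H J)"
    unfolding Q_def using J supp
    by (intro measurable_quantize_fresh measurable_H_mono[OF L2_measurable_H[OF V]]) auto
  show L2Q: "L2 J Q"
  proof (rule L2_bound[OF J(2) QJ])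
    show "integrable P (\<lambda>\<omega>. (real CARD('d))\<^sup>2 * (norm (V \<omega>))\<^sup>2)"
      using L2_integrable[OF V] by auto
    show "(norm (Q \<omega>))\<^sup>2 \<le> (real CARD('d))\<^sup>2 * (norm (V \<omega>))\<^sup>2" for \<omega>
      unfolding Q_def power_mult_distrib[symmetric] by (intro power_mono norm_quantize_le s) simp
  qed
  assume Z: "L2 I Z"
  have "integrable P (\<lambda>\<omega>. Z \<omega> $ i * (Q \<omega> $ i - V \<omega> $ i)) \<and>
      expectation (\<lambda>\<omega>. Z \<omega> $ i * (Q \<omega> $ i - V \<omega> $ i)) = 0" for i
  proof (cases "i \<in> segment M j")
    case True
    have I: "I \<subseteq> draws" "Seed n j t i \<in> draws" "Seed n j t i \<notin> I"
      using J True by auto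
    have ci: "(\<lambda>\<omega>. X \<omega> $ i) \<in> borel_measurable P" if "X \<in> borel_measurable P" for X :: "'p \<Rightarrow> (real, 'd) vec"
      using borel_measurable_inner[OF that borel_measurable_const[of "axis i 1"]] by (simp add: inner_axis)
    note [measurable] = ci[OF L2_measurable[OF Z]] ci[OF L2_measurable[OF V]] ci[OF L2_measurable[OF L2Q]]
    have int: "integrable P (\<lambda>\<omega>. Z \<omega> $ i * (Q \<omega> $ i - V \<omega> $ i))"
    proof (rule Bochner_Integration.integrable_bound)
      show "integrable P (\<lambda>\<omega>. (norm (Z \<omega>))\<^sup>2 + 4 * (norm (V \<omega>))\<^sup>2)"
        using Z V by (auto simp: L2_integrable)
      show "AE \<omega> in P. norm (Z \<omega> $ i * (Q \<omega> $ i - V \<omega> $ i)) \<le> norm ((norm (Z \<omega>))\<^sup>2 + 4 * (norm (V \<omega>))\<^sup>2)"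
      proof (rule AE_I2)
        fix \<omega>
        have "\<bar>Q \<omega> $ i - V \<omega> $ i\<bar> \<le> 2 * norm (V \<omega>)"
          using abs_quantize_le[OF s, of "\<lambda>i. u n j t i \<omega>" "V \<omega>" i] component_le_norm_cart[of "V \<omega>" i]
          by (auto simp: Q_def)
        then have "\<bar>Z \<omega> $ i * (Q \<omega> $ i - V \<omega> $ i)\<bar> \<le> norm (Z \<omega>) * (2 * norm (V \<omega>))"
          unfolding abs_mult using component_le_norm_cart[of "Z \<omega>" i] by (intro mult_mono) auto
        also have "\<dots> \<le> (norm (Z \<omega>))\<^sup>2 + (2 * norm (V \<omega>))\<^sup>2"
          using abs_inner_le_power2[of "norm (Z \<omega>)" "2 * norm (V \<omega>)"] by simp
        finally show "norm (Z \<omega> $ i * (Q \<omega> $ i - V \<omega> $ i)) \<le> norm ((norm (Z \<omega>))\<^sup>2 + 4 * (norm (V \<omega>))\<^sup>2)"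
          by (simp add: power_mult_distrib)
      qed
    qed measurable
    define \<phi> :: "((real, 'd) vec \<times> (real, 'd) vec) \<times> real \<Rightarrow> real" where
      "\<phi> p = fst (fst p) $ i * (norm (snd (fst p)) * sgn (snd (fst p) $ i) *
          quant_zeta s (\<bar>snd (fst p) $ i\<bar> / norm (snd (fst p))) (snd p) / real s - snd (fst p) $ i)" for p
    have ZV: "(\<lambda>\<omega>. (Z \<omega>, V \<omega>)) \<in> measurable (H I) (borel \<Otimes>\<^sub>M borel)"
      using L2_measurable_H[OF Z] L2_measurable_H[OF V] by measurable
    have "expectation (\<lambda>\<omega>. \<phi> ((Z \<omega>, V \<omega>), u n j t i \<omega>)) = 0"
    proof (rule integral_indep_zero[OF _ _ seed_prod[OF I ZV]])
      show "(\<lambda>\<omega>. (Z \<omega>, V \<omega>)) \<in> measurable P (borel \<Otimes>\<^sub>M borel)"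
        by (rule measurable_H_P[OF ZV I(1)])
      show "u n j t i \<in> borel_measurable P"
        using I(2) by (intro measurable_H_P[OF measurable_seed]) auto
      show "integrable P (\<lambda>\<omega>. \<phi> ((Z \<omega>, V \<omega>), u n j t i \<omega>))"
        using int by (simp add: \<phi>_def Q_def quantize_component)
      have [measurable]: "(\<lambda>x :: (real, 'd) vec. x $ i) \<in> borel_measurable borel"
        by (intro borel_measurable_continuous_onI continuous_intros)
      show "\<phi> \<in> borel_measurable ((borel \<Otimes>\<^sub>M borel) \<Otimes>\<^sub>M borel)"
        unfolding \<phi>_def by measurable
      fix zx :: "(real, 'd) vec \<times> (real, 'd) vec"
      obtain z v where zx: "zx = (z, v)" by (cases zx)
      let ?U = "uniform_measure lborel {0..1::real}"
      interpret U: prob_space ?U by (rule prob_space_uniform_measure) auto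
      define r where "r = \<bar>v $ i\<bar> / norm v"
      have r: "0 \<le> r" "r \<le> 1"
        using component_le_norm_cart[of v i] by (auto simp: r_def divide_le_eq_1)
      have [simp]: "integrable ?U (quant_zeta s r)"
      proof (rule U.integrable_const_bound[where B = "real s"])
        show "AE x in ?U. norm (quant_zeta s r x) \<le> real s"
          using quant_level_works(1)[OF s r] by (auto simp: quant_zeta_def)
      qed simp
      \<comment> \<open>True at \<open>v = 0\<close> as well, where both sides vanish, so the inner
        integral is zero for every \<open>v\<close>.\<close>
      have "norm v * sgn (v $ i) * (r * real s) / real s = v $ i"
        using s by (auto simp: r_def sgn_mult_abs)
      then have "(\<integral>y. z $ i * (norm v * sgn (v $ i) * quant_zeta s r y / real s - v $ i) \<partial>?U) = 0"
        using integral_quant_zeta[OF s r] U.prob_space by simp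
      then show "(\<integral>y. \<phi> (zx, y) \<partial>distr P borel (u n j t i)) = 0"
        by (simp add: seed_law[OF I(2)] \<phi>_def zx r_def)
    qed
    with int show ?thesis by (simp add: \<phi>_def Q_def quantize_component)
  qed (simp add: Q_def quantize_component_zero supp)
  then show "expectation (\<lambda>\<omega>. Z \<omega> \<bullet> (Q \<omega> - V \<omega>)) = 0"
    by (simp add: inner_vec_def)
qed

end

subsection \<open>Nested quantization on the ring\<close>

text \<open>Every quantization on the way costs at most a factor \<open>d\<close>, the dimension,
  and the first summand passes through \<open>t + 1\<close> of them.\<close>

lemma norm_nested_quant_le:
  fixes h :: "nat \<Rightarrow> real ^ 'd"
  assumes "s \<ge> 1"
  shows "norm (nested_quant s u h t) \<le> real CARD('d) ^ Suc t * (\<Sum>t'\<le>t. norm (h t'))"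
proof (induction t)
  case 0
  then show ?case using norm_quantize_le[OF assms] by simp
next
  case (Suc t)
  let ?d = "real CARD('d)"
  have d: "1 \<le> ?d" using zero_less_card_finite[where 'a = 'd] by linarith
  have "norm (nested_quant s u h (Suc t)) \<le> ?d * norm (nested_quant s u h t + h (Suc t))"
    by (simp add: norm_quantize_le[OF assms])
  also have "\<dots> \<le> ?d * (?d ^ Suc t * (\<Sum>t'\<le>t. norm (h t')) + ?d ^ Suc t * norm (h (Suc t)))"
  proof (intro mult_left_mono order_trans[OF norm_triangle_ineq] add_mono Suc.IH)
    \<comment> \<open>The newest summand is charged the full power, which is possible since the
      dimension is at least 1, so that the bound remains one multiple of one sum.\<close>
    show "norm (h (Suc t)) \<le> ?d ^ Suc t * norm (h (Suc t))"
      using mult_right_mono[OF one_le_power[OF d, of "Suc t"], of "norm (h (Suc t))"] by simp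
  qed simp
  also have "\<dots> = ?d ^ Suc (Suc t) * (\<Sum>t'\<le>Suc t. norm (h t'))"
    by (simp add: algebra_simps)
  finally show ?case .
qed

lemma nested_quant_component_zero:
  assumes "\<And>t. h t $ i = 0"
  shows "nested_quant s u h t $ i = 0"
  by (induction t) (simp_all add: assms quantize_component_zero)

lemma linear_seg_part: "linear (seg_part M j)"
  by (rule linearI) (auto simp: seg_part_def vec_eq_iff)

lemma seg_part_component: "seg_part M j v $ i = (if i \<in> segment M j then v $ i else 0)"
  by (simp add: seg_part_def)

lemma norm_seg_part_le: "norm (seg_part M j v) \<le> norm v"
  by (rule norm_le_componentwise_cart) (simp add: seg_part_component)

lemma coord_index_less: "coord_index (i :: 'd :: {finite, linorder}) < CARD('d)"
  unfolding coord_index_def by (rule psubset_card_mono) auto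

text \<open>Divisibility makes the block length exactly \<open>d / M\<close>, so no coordinate falls
  into a block with index \<open>M\<close> or beyond.\<close>

lemma sum_seg_part:
  fixes v :: "real ^ ('d :: {finite, linorder})"
  assumes "M dvd CARD('d)" "M \<ge> 1"
  shows "(\<Sum>j<M. seg_part M j v) = v"
proof -
  have pos: "CARD('d) div M > 0"
    using assms by (auto simp: div_greater_zero_iff intro: dvd_imp_le)
  have "coord_index i div (CARD('d) div M) < M" for i :: 'd
    using coord_index_less[of i] assms by (simp add: less_mult_imp_div_less)
  then show ?thesis
    by (simp add: vec_eq_iff seg_part_component segment_def)
qed

text \<open>Rotation permutes the residues modulo \<open>M\<close>: every segment collects each
  worker exactly once.\<close>

lemma sum_ring:
  fixes \<phi> :: "nat \<Rightarrow> 'b :: comm_monoid_add"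
  assumes "M \<ge> 1"
  shows "(\<Sum>t<M. \<phi> ((j + t) mod M)) = (\<Sum>m<M. \<phi> m)"
proof (rule sum.reindex_bij_betw)
  have "inj_on (\<lambda>t. (j + t) mod M) {..<M}"
  proof (rule linorder_inj_onI)
    fix t t' assume *: "t < t'" "t \<in> {..<M}" "t' \<in> {..<M}"
    then have "\<not> M dvd (j + t') - (j + t)" by (auto dest: dvd_imp_le)
    then have "(j + t') mod M \<noteq> (j + t) mod M"
      using * by (subst mod_eq_dvd_iff_nat) auto
    then show "(j + t) mod M \<noteq> (j + t') mod M" by simp
  qed auto
  then show "bij_betw (\<lambda>t. (j + t) mod M) {..<M} {..<M}"
    using assms by (intro bij_betw_imageI endo_inj_surj) auto
qed

lemma norm_quantized_all_reduce_le:
  fixes g :: "nat \<Rightarrow> real ^ ('d :: {finite, linorder})"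
  assumes "s \<ge> 1" "M \<ge> 1"
  shows "norm (quantized_all_reduce M s u g) \<le> real M * (real CARD('d) ^ M * (\<Sum>m<M. norm (g m)))"
proof -
  have "norm (nested_quant s (u j) (\<lambda>t. seg_part M j (g ((j + t) mod M))) (M - 1))
      \<le> real CARD('d) ^ M * (\<Sum>m<M. norm (g m))" for j
  proof -
    have "norm (nested_quant s (u j) (\<lambda>t. seg_part M j (g ((j + t) mod M))) (M - 1))
      \<le> real CARD('d) ^ Suc (M - 1) * (\<Sum>t\<le>M - 1. norm (seg_part M j (g ((j + t) mod M))))"
      by (rule norm_nested_quant_le[OF assms(1)])
    also have "\<dots> \<le> real CARD('d) ^ Suc (M - 1) * (\<Sum>t\<le>M - 1. norm (g ((j + t) mod M)))"
      by (intro mult_left_mono sum_mono norm_seg_part_le) auto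
    also have "{..M - 1} = {..<M}" using assms(2) by auto
    also have "(\<Sum>t<M. norm (g ((j + t) mod M))) = (\<Sum>m<M. norm (g m))"
      by (rule sum_ring[OF assms(2)])
    finally show ?thesis using assms(2) by simp
  qed
  then have "norm (quantized_all_reduce M s u g) \<le> (\<Sum>j<M. real CARD('d) ^ M * (\<Sum>m<M. norm (g m)))"
    unfolding quantized_all_reduce_def by (intro order_trans[OF norm_sum] sum_mono)
  then show ?thesis by simp
qed

text \<open>Here \<open>M \<le> d\<close> removes the dependence on \<open>M\<close>: the pathwise
  factor \<open>d ^ M + 1 / M\<close> becomes \<open>d ^ d + 1\<close>, and the factor
  \<open>M\<^sup>2\<close> that remains when the squared sum of norms is replaced by an average of
  squares becomes \<open>d\<^sup>2\<close>.\<close>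

definition quant_const :: "nat \<Rightarrow> real" where
  "quant_const d = ((real d ^ d + 1) * real d)\<^sup>2"

lemma quantization_error_le:
  fixes g :: "nat \<Rightarrow> real ^ ('d :: {finite, linorder})"
  assumes "s \<ge> 1" "M \<ge> 1" "M dvd CARD('d)"
  shows "(norm ((1 / real M) *\<^sub>R (quantized_all_reduce M s u g - (\<Sum>m<M. g m))))\<^sup>2
    \<le> quant_const CARD('d) * ((1 / real M) * (\<Sum>m<M. (norm (g m))\<^sup>2))"
proof -
  let ?d = "real CARD('d)" and ?S = "\<Sum>m<M. norm (g m)"
  have d: "1 \<le> ?d" using zero_less_card_finite[where 'a = 'd] by linarith
  have Md: "M \<le> CARD('d)" using assms(3) by (intro dvd_imp_le) simp_all
  have "norm ((1 / real M) *\<^sub>R (quantized_all_reduce M s u g - (\<Sum>m<M. g m)))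
      \<le> (1 / real M) * (real M * (?d ^ M * ?S) + ?S)"
    unfolding norm_scaleR using assms
    by (intro mult_mono order_trans[OF norm_triangle_ineq4] add_mono norm_quantized_all_reduce_le norm_sum) auto
  also have "\<dots> = (?d ^ M + 1 / real M) * ?S"
    using assms(2) by (simp add: field_simps)
  also have "\<dots> \<le> (?d ^ CARD('d) + 1) * ?S"
    using assms(2) Md d by (intro mult_right_mono add_mono power_increasing sum_nonneg) auto
  finally have "(norm ((1 / real M) *\<^sub>R (quantized_all_reduce M s u g - (\<Sum>m<M. g m))))\<^sup>2 \<le> ((?d ^ CARD('d) + 1) * ?S)\<^sup>2"
    by (intro power_mono) auto
  also have "\<dots> \<le> (?d ^ CARD('d) + 1)\<^sup>2 * (real M * (\<Sum>m<M. (norm (g m))\<^sup>2))"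
    unfolding power_mult_distrib
    using sum_squared_le_sum_of_squares[of "\<lambda>m. norm (g m)" "{..<M}"]
    by (intro mult_left_mono) (simp_all add: mult.commute)
  also have "\<dots> = (?d ^ CARD('d) + 1)\<^sup>2 * ((real M)\<^sup>2 * ((1 / real M) * (\<Sum>m<M. (norm (g m))\<^sup>2)))"
    using assms(2) by (simp add: power2_eq_square)
  also have "\<dots> \<le> (?d ^ CARD('d) + 1)\<^sup>2 * (?d\<^sup>2 * ((1 / real M) * (\<Sum>m<M. (norm (g m))\<^sup>2)))"
    using Md by (intro mult_left_mono mult_right_mono power_mono) (auto intro!: sum_nonneg divide_nonneg_nonneg)
  finally show ?thesis by (simp add: quant_const_def power_mult_distrib mult.assoc)
qed

subsection \<open>Adaptedness of the iterates\<close>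

context ar_run
begin

text \<open>In the notation of the algorithm, \<open>xt n\<close>, \<open>xl n k m\<close>, \<open>xb n k\<close> and \<open>upd n m\<close> are
  \<open>x\<^sub>n\<close> (with tilde), \<open>x\<^sub>n\<^sub>;\<^sub>k\<close> of worker \<open>m\<close>, the average of the latter over the workers, and
  \<open>g\<^sub>n\<close> of worker \<open>m\<close>.\<close>

definition xt :: "nat \<Rightarrow> 'p \<Rightarrow> (real, 'd) vec" where
  "xt n \<omega> = ar_iterate M K s f (\<lambda>_. c) x1 (\<lambda>n k m. \<xi> n k m \<omega>) (\<lambda>n j t i. u n j t i \<omega>) n"

definition xl :: "nat \<Rightarrow> nat \<Rightarrow> nat \<Rightarrow> 'p \<Rightarrow> (real, 'd) vec" where
  "xl n k m \<omega> = local_sgd (G m) c (\<lambda>k. \<xi> n k m \<omega>) (xt n \<omega>) k"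

definition xb :: "nat \<Rightarrow> nat \<Rightarrow> 'p \<Rightarrow> (real, 'd) vec" where
  "xb n k \<omega> = (1 / real M) *\<^sub>R (\<Sum>m<M. xl n k m \<omega>)"

definition noise :: "nat \<Rightarrow> nat \<Rightarrow> nat \<Rightarrow> 'p \<Rightarrow> (real, 'd) vec" where
  "noise n k m \<omega> = G m (xl n k m \<omega>) (\<xi> n k m \<omega>) - gFw m (xl n k m \<omega>)"

definition upd :: "nat \<Rightarrow> nat \<Rightarrow> 'p \<Rightarrow> (real, 'd) vec" where
  "upd n m \<omega> = xt n \<omega> - xl n K m \<omega>"

definition nq :: "nat \<Rightarrow> nat \<Rightarrow> nat \<Rightarrow> 'p \<Rightarrow> (real, 'd) vec" where
  "nq n j t \<omega> = nested_quant s (\<lambda>t i. u n j t i \<omega>) (\<lambda>t. seg_part M j (upd n ((j + t) mod M) \<omega>)) t"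

definition qerr :: "nat \<Rightarrow> 'p \<Rightarrow> (real, 'd) vec" where
  "qerr n \<omega> = (1 / real M) *\<^sub>R ((\<Sum>j<M. nq n j (M - 1) \<omega>) - (\<Sum>m<M. upd n m \<omega>))"

lemma ar_average_eq:
  "ar_average M K s f (\<lambda>_. c) x1 (\<lambda>n k m. \<xi> n k m \<omega>) (\<lambda>n j t i. u n j t i \<omega>) n k = xb n k \<omega>"
  by (simp add: ar_average_def xb_def xl_def xt_def)

lemma xt_0: "xt 0 \<omega> = x1"
  by (simp add: xt_def)

lemma xl_0: "xl n 0 m \<omega> = xt n \<omega>"
  by (simp add: xl_def)

lemma xl_Suc: "xl n (Suc k) m \<omega> = xl n k m \<omega> - c *\<^sub>R (gFw m (xl n k m \<omega>) + noise n k m \<omega>)"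
  by (simp add: xl_def noise_def)

lemma xl_sum: "xl n k m \<omega> = xt n \<omega> - c *\<^sub>R (\<Sum>l<k. gFw m (xl n l m \<omega>) + noise n l m \<omega>)"
  by (induction k) (simp_all add: xl_0 xl_Suc scaleR_add_right)

lemma xb_0: "xb n 0 \<omega> = xt n \<omega>"
  using M by (simp add: xb_def xl_0 sum_constant_scaleR del: sum_constant)

lemma xb_Suc:
  "xb n (Suc k) \<omega> = xb n k \<omega> - c *\<^sub>R ((1 / real M) *\<^sub>R (\<Sum>m<M. gFw m (xl n k m \<omega>)) + (1 / real M) *\<^sub>R (\<Sum>m<M. noise n k m \<omega>))"
  by (simp add: xb_def xl_Suc sum_subtractf sum.distrib scaleR_diff_right scaleR_add_right
      scaleR_sum_right mult.commute)

text \<open>Exact communication would return the average of the last local iterates. A round is thus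
  \<open>K\<close> local steps of the average followed by one perturbation by the quantization
  error.\<close>

lemma xt_Suc: "xt (Suc n) \<omega> = xb n K \<omega> - qerr n \<omega>"
proof -
  have "xt (Suc n) \<omega> = xt n \<omega> - (1 / real M) *\<^sub>R (\<Sum>j<M. nq n j (M - 1) \<omega>)"
    by (simp add: xt_def xl_def upd_def nq_def quantized_all_reduce_def Let_def)
  moreover have "xb n K \<omega> = xt n \<omega> - (1 / real M) *\<^sub>R (\<Sum>m<M. upd n m \<omega>)"
    using M by (simp add: xb_def upd_def sum_subtractf sum_constant_scaleR algebra_simps del: sum_constant)
  ultimately show ?thesis
    by (simp add: qerr_def algebra_simps)
qed

lemma qerr_norm_le:
  "(norm (qerr n \<omega>))\<^sup>2 \<le> quant_const CARD('d) * ((1 / real M) * (\<Sum>m<M. (norm (upd n m \<omega>))\<^sup>2))"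
  using quantization_error_le[OF s M M_dvd, of "\<lambda>j t i. u n j t i \<omega>" "\<lambda>m. upd n m \<omega>"]
  by (simp add: qerr_def nq_def quantized_all_reduce_def)

text \<open>\<open>hist n k\<close> contains the draws made before local step \<open>k\<close> of round \<open>n\<close>, and \<open>qhist n j t\<close>
  those that precede position \<open>t\<close> of the ring reduction of segment \<open>j\<close>. The seeds of the other
  segments in round \<open>n\<close> are left out, as no order between the segments is needed.\<close>

definition hist :: "nat \<Rightarrow> nat \<Rightarrow> 'd draw set" where
  "hist n k = {e \<in> draws. case e of Sample n' k' m \<Rightarrow> n' < n \<or> n' = n \<and> k' < k | Seed n' j t i \<Rightarrow> n' < n}"

definition qhist :: "nat \<Rightarrow> nat \<Rightarrow> nat \<Rightarrow> 'd draw set" where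
  "qhist n j t = hist n K \<union> {Seed n j t' i |t' i. n < N \<and> j < M \<and> t' < M \<and> t' < t \<and> i \<in> segment M j}"

lemma hist_subset: "hist n k \<subseteq> draws"
  by (auto simp: hist_def)

lemma qhist_subset: "qhist n j t \<subseteq> draws"
  using hist_subset by (auto simp: qhist_def draws_def)

lemma hist_mono: "k \<le> k' \<Longrightarrow> hist n k \<subseteq> hist n k'"
  by (auto simp: hist_def split: draw.splits)

lemma hist_qhist: "hist n K \<subseteq> qhist n j t"
  by (auto simp: qhist_def)

lemma qhist_hist: "qhist n j t \<subseteq> hist (Suc n) 0"
  by (auto simp: qhist_def hist_def draws_def split: draw.splits)

lemma L2_seg_part:
  assumes "L2 I X"
  shows "L2 I (\<lambda>\<omega>. seg_part M j (X \<omega>))"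
proof (rule L2_bound)
  have "seg_part M j \<in> borel_measurable borel"
    using linear_seg_part by (intro borel_measurable_continuous_onI linear_continuous_on) (simp add: linear_linear)
  then show "(\<lambda>\<omega>. seg_part M j (X \<omega>)) \<in> borel_measurable (H I)"
    using L2_measurable_H[OF assms] by (rule measurable_compose[rotated])
  show "integrable P (\<lambda>\<omega>. (norm (X \<omega>))\<^sup>2)" by (rule L2_integrable[OF assms])
qed (use assms in \<open>auto simp: norm_seg_part_le power_mono intro: L2_subset[THEN subsetD]\<close>)

text \<open>Square integrability of \<open>xt n\<close> is a hypothesis here and in the lemmas on
  the ring, because it is obtained only in \<open>L2_xt\<close>, by an induction over rounds that
  relies on them.\<close>

lemma L2_local:
  assumes "n < N" "m < M" "L2 (hist n 0) (xt n)" "k \<le> K"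
  shows "L2 (hist n k) (xl n k m)"
  using assms(4)
proof (induction k)
  case 0
  then show ?case using assms(3) by (simp add: xl_0[abs_def])
next
  case (Suc k)
  then have X: "L2 (hist n k) (xl n k m)" and k: "k < K" by auto
  have S: "Sample n k m \<in> draws" "Sample n k m \<notin> hist n k"
    using assms k by (auto simp: draws_def hist_def)
  have ins: "insert (Sample n k m) (hist n k) \<subseteq> hist n (Suc k)"
    using S(1) by (auto simp: hist_def split: draw.splits)
  have "L2 (hist n (Suc k)) (noise n k m)"
    using L2_mono[OF noise_moments(1)[OF hist_subset S L2_measurable_H[OF X]] ins hist_subset]
    by (simp add: noise_def[abs_def])
  moreover have X': "L2 (hist n (Suc k)) (xl n k m)"
    by (rule L2_mono[OF X hist_mono hist_subset]) simp
  ultimately show ?case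
    using L2_lipschitz[OF X' worker_lipschitz[OF assms(2)]]
    by (simp add: xl_Suc[abs_def] L2_diff L2_scale L2_add)
qed

lemma L2_upd:
  assumes "n < N" "m < M" "L2 (hist n 0) (xt n)"
  shows "L2 (hist n K) (upd n m)"
proof -
  have "L2 (hist n K) (xt n)"
    using assms(3) by (rule L2_mono) (auto intro: hist_mono[THEN subsetD] hist_subset[THEN subsetD])
  then show ?thesis
    unfolding upd_def[abs_def] using L2_local[OF assms] by (intro L2_diff) auto
qed

section \<open>Unbiasedness of the ring reduction\<close>

definition seg_upd :: "nat \<Rightarrow> nat \<Rightarrow> nat \<Rightarrow> 'p \<Rightarrow> (real, 'd) vec" where
  "seg_upd n j t \<omega> = seg_part M j (upd n ((j + t) mod M) \<omega>)"

lemma L2_seg_upd: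
  assumes "n < N" "L2 (hist n 0) (xt n)"
  shows "L2 (hist n K) (seg_upd n j t)"
  unfolding seg_upd_def[abs_def] using M by (intro L2_seg_part L2_upd assms) auto

lemma seg_upd_zero: "i \<notin> segment M j \<Longrightarrow> seg_upd n j t \<omega> $ i = 0"
  by (simp add: seg_upd_def seg_part_component)

lemma nq_zero: "i \<notin> segment M j \<Longrightarrow> nq n j t \<omega> $ i = 0"
  unfolding nq_def by (rule nested_quant_component_zero) (simp add: seg_part_component)

text \<open>\<open>W\<close> is the partial result arriving from the previous position;
  \<open>W = 0\<close> covers the start of the ring, so both cases of the later induction are
  instances.\<close>

lemma nested_step:
  assumes n: "n < N" and j: "j < M" and t: "t < M" and X: "L2 (hist n 0) (xt n)"
    and W: "L2 (qhist n j t) W" "\<forall>i \<omega>. i \<notin> segment M j \<longrightarrow> W \<omega> $ i = 0"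
    and step: "nq n j t = (\<lambda>\<omega>. quantize s (\<lambda>i. u n j t i \<omega>) (W \<omega> + seg_upd n j t \<omega>))"
  shows "L2 (qhist n j (Suc t)) (nq n j t)"
    and "L2 (hist n K) Z \<Longrightarrow> expectation (\<lambda>\<omega>. Z \<omega> \<bullet> (nq n j t \<omega> - (W \<omega> + seg_upd n j t \<omega>))) = 0"
proof -
  have V: "L2 (qhist n j t) (\<lambda>\<omega>. W \<omega> + seg_upd n j t \<omega>)"
    by (intro L2_add W(1) L2_mono[OF L2_seg_upd[OF n X] hist_qhist qhist_subset])
  have supp: "(W \<omega> + seg_upd n j t \<omega>) $ i = 0" if "i \<notin> segment M j" for \<omega> i
    using that by (simp add: W(2) seg_upd_zero)
  have *: "qhist n j t \<subseteq> qhist n j (Suc t)" "qhist n j (Suc t) \<subseteq> draws"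
    "\<And>i. i \<in> segment M j \<Longrightarrow> Seed n j t i \<in> qhist n j (Suc t) - qhist n j t"
    using n j t qhist_subset[of n j "Suc t"] by (auto simp: qhist_def hist_def)
  show "L2 (qhist n j (Suc t)) (nq n j t)"
    using quantize_fresh(1)[OF V supp *] by (simp add: step)
  show "expectation (\<lambda>\<omega>. Z \<omega> \<bullet> (nq n j t \<omega> - (W \<omega> + seg_upd n j t \<omega>))) = 0" if "L2 (hist n K) Z"
    using quantize_fresh(2)[OF V supp * L2_mono[OF that hist_qhist qhist_subset]] by (simp add: step)
qed

text \<open>Although each quantizer acts on an already quantized sum, biases do not build up: the
  error at a position is its fresh error plus the inherited one, and both are orthogonal to what was
  known before communication. Square integrability is carried along because the next position needs
  it.\<close>

lemma nested_unbiased: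
  assumes n: "n < N" and j: "j < M" and t: "t < M" and X: "L2 (hist n 0) (xt n)"
  shows "L2 (qhist n j (Suc t)) (nq n j t) \<and>
    (\<forall>Z. L2 (hist n K) Z \<longrightarrow> expectation (\<lambda>\<omega>. Z \<omega> \<bullet> (nq n j t \<omega> - (\<Sum>t'\<le>t. seg_upd n j t' \<omega>))) = 0)"
  using t
proof (induction t)
  case 0
  have "nq n j 0 = (\<lambda>\<omega>. quantize s (\<lambda>i. u n j 0 i \<omega>) (0 + seg_upd n j 0 \<omega>))"
    by (simp add: nq_def seg_upd_def fun_eq_iff)
  note step = nested_step[OF n j 0 X L2_const[OF qhist_subset] _ this]
  show ?case using step by simp
next
  case (Suc t)
  then have t: "t < M" and IH: "L2 (qhist n j (Suc t)) (nq n j t)"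
      "\<And>Z. L2 (hist n K) Z \<Longrightarrow> expectation (\<lambda>\<omega>. Z \<omega> \<bullet> (nq n j t \<omega> - (\<Sum>t'\<le>t. seg_upd n j t' \<omega>))) = 0"
    by auto
  have zero: "\<forall>i \<omega>. i \<notin> segment M j \<longrightarrow> nq n j t \<omega> $ i = 0"
    by (simp add: nq_zero)
  have "nq n j (Suc t) = (\<lambda>\<omega>. quantize s (\<lambda>i. u n j (Suc t) i \<omega>) (nq n j t \<omega> + seg_upd n j (Suc t) \<omega>))"
    by (simp add: nq_def seg_upd_def fun_eq_iff)
  note step = nested_step[OF n j Suc.prems X IH(1) zero this]
  have "expectation (\<lambda>\<omega>. Z \<omega> \<bullet> (nq n j (Suc t) \<omega> - (\<Sum>t'\<le>Suc t. seg_upd n j t' \<omega>))) = 0"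
    if Z: "L2 (hist n K) Z" for Z
  proof -
    have S: "L2 (hist n K) (seg_upd n j t')" for t' by (rule L2_seg_upd[OF n X])
    have S': "L2 (hist n K) (\<lambda>\<omega>. \<Sum>t'\<le>t. seg_upd n j t' \<omega>)"
      by (intro L2_sum hist_subset S) simp
    have mono: "L2 (qhist n j (Suc (Suc t))) Y" if "L2 (qhist n j (Suc t)) Y" for Y
      using that by (rule L2_mono) (use qhist_subset in \<open>auto simp: qhist_def\<close>)
    have q: "L2 (hist n K) Y \<Longrightarrow> L2 (qhist n j (Suc (Suc t))) Y" for Y
      by (rule L2_mono[OF _ hist_qhist qhist_subset])
    have i: "integrable P (\<lambda>\<omega>. Z \<omega> \<bullet> (nq n j (Suc t) \<omega> - (nq n j t \<omega> + seg_upd n j (Suc t) \<omega>)))"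
        "integrable P (\<lambda>\<omega>. Z \<omega> \<bullet> (nq n j t \<omega> - (\<Sum>t'\<le>t. seg_upd n j t' \<omega>)))"
      using integrable_inner_L2[OF Z L2_diff[OF step(1) L2_add[OF mono[OF IH(1)] q[OF S]]]]
        integrable_inner_L2[OF Z L2_diff[OF mono[OF IH(1)] q[OF S']]] by auto
    \<comment> \<open>The partial result \<open>nq n j t\<close> is inserted to separate the fresh
      error from the inherited one.\<close>
    have "expectation (\<lambda>\<omega>. Z \<omega> \<bullet> (nq n j (Suc t) \<omega> - (\<Sum>t'\<le>Suc t. seg_upd n j t' \<omega>))) =
        expectation (\<lambda>\<omega>. Z \<omega> \<bullet> (nq n j (Suc t) \<omega> - (nq n j t \<omega> + seg_upd n j (Suc t) \<omega>)) +
          Z \<omega> \<bullet> (nq n j t \<omega> - (\<Sum>t'\<le>t. seg_upd n j t' \<omega>)))"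
      by (simp add: inner_diff_right inner_add_right algebra_simps)
    also have "\<dots> = 0"
      using step(2)[OF Z] IH(2)[OF Z] by (simp add: Bochner_Integration.integral_add[OF i])
    finally show ?thesis .
  qed
  then show ?case using step(1) by blast
qed

text \<open>Splits the error by segments. The exact sums agree because a segment meets all workers
  in rotated order and the segments together recover the whole vector.\<close>

lemma qerr_eq: "qerr n \<omega> = (1 / real M) *\<^sub>R (\<Sum>j<M. nq n j (M - 1) \<omega> - (\<Sum>t\<le>M - 1. seg_upd n j t \<omega>))"
proof -
  have "(\<Sum>t\<le>M - 1. seg_upd n j t \<omega>) = seg_part M j (\<Sum>m<M. upd n m \<omega>)" for j
  proof -
    have "(\<Sum>t\<le>M - 1. seg_upd n j t \<omega>) = (\<Sum>t<M. seg_part M j (upd n ((j + t) mod M) \<omega>))"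
      unfolding seg_upd_def using M by (intro sum.cong) auto
    then show ?thesis
      using sum_ring[OF M, of "\<lambda>m. seg_part M j (upd n m \<omega>)" j]
      by (simp add: linear_sum[OF linear_seg_part])
  qed
  then show ?thesis
    by (simp add: qerr_def sum_subtractf sum_seg_part[OF M_dvd M])
qed

lemma qerr_L2:
  assumes n: "n < N" and X: "L2 (hist n 0) (xt n)"
  shows "L2 (hist (Suc n) 0) (qerr n)"
    and "L2 (hist n K) Z \<Longrightarrow> expectation (\<lambda>\<omega>. Z \<omega> \<bullet> qerr n \<omega>) = 0"
proof -
  let ?\<delta> = "\<lambda>j \<omega>. nq n j (M - 1) \<omega> - (\<Sum>t\<le>M - 1. seg_upd n j t \<omega>)"
  have M1: "M - 1 < M" using M by simp
  have h: "L2 (hist (Suc n) 0) Y" if "L2 (qhist n j t) Y" for j t Y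
    using that qhist_hist hist_subset by (rule L2_mono)
  have \<delta>: "L2 (hist (Suc n) 0) (?\<delta> j)" if j: "j < M" for j
  proof (rule L2_diff)
    show "L2 (hist (Suc n) 0) (nq n j (M - 1))"
      using nested_unbiased[OF n j M1 X] h by blast
    show "L2 (hist (Suc n) 0) (\<lambda>\<omega>. \<Sum>t\<le>M - 1. seg_upd n j t \<omega>)"
      by (intro L2_sum hist_subset h[OF L2_mono[OF L2_seg_upd[OF n X] hist_qhist qhist_subset]]) simp
  qed
  show "L2 (hist (Suc n) 0) (qerr n)"
    unfolding qerr_eq[abs_def] by (intro L2_scale L2_sum hist_subset \<delta>) auto
  assume Z: "L2 (hist n K) Z"
  have "expectation (\<lambda>\<omega>. Z \<omega> \<bullet> qerr n \<omega>) = (1 / real M) * expectation (\<lambda>\<omega>. \<Sum>j<M. Z \<omega> \<bullet> ?\<delta> j \<omega>)"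
    by (simp add: qerr_eq inner_sum_right)
  also have "expectation (\<lambda>\<omega>. \<Sum>j<M. Z \<omega> \<bullet> ?\<delta> j \<omega>) = (\<Sum>j<M. expectation (\<lambda>\<omega>. Z \<omega> \<bullet> ?\<delta> j \<omega>))"
    by (intro Bochner_Integration.integral_sum integrable_inner_L2[OF Z \<delta>]) auto
  also have "\<dots> = 0"
    using nested_unbiased[OF n _ M1 X] Z by (intro sum.neutral) auto
  finally show "expectation (\<lambda>\<omega>. Z \<omega> \<bullet> qerr n \<omega>) = 0" by simp
qed

lemma L2_xb:
  assumes "n < N" "L2 (hist n 0) (xt n)" "k \<le> K"
  shows "L2 (hist n k) (xb n k)"
  unfolding xb_def[abs_def] using assms by (intro L2_scale L2_sum hist_subset L2_local) auto

lemma L2_xt: "n \<le> N \<Longrightarrow> L2 (hist n 0) (xt n)"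
proof (induction n)
  case 0
  then show ?case by (simp add: xt_0[abs_def] L2_const hist_subset)
next
  case (Suc n)
  then have n: "n < N" and X: "L2 (hist n 0) (xt n)" by auto
  have "L2 (hist (Suc n) 0) (xb n K)"
    by (rule L2_mono[OF L2_xb[OF n X order_refl] subset_trans[OF hist_qhist qhist_hist] hist_subset])
  then show ?case
    unfolding xt_Suc[abs_def] by (intro L2_diff qerr_L2(1)[OF n X])
qed

subsection \<open>Descent in expectation\<close>

lemma noise_sample:
  assumes "n < N" "k < K" "m < M"
  shows "L2 (hist n (Suc k)) (noise n k m)" "expectation (\<lambda>\<omega>. (norm (noise n k m \<omega>))\<^sup>2) \<le> \<sigma>\<^sup>2"
    "L2 (hist n k) Z \<Longrightarrow> expectation (\<lambda>\<omega>. Z \<omega> \<bullet> noise n k m \<omega>) = 0"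
proof -
  have X: "L2 (hist n k) (xl n k m)"
    using assms by (intro L2_local L2_xt) auto
  have S: "Sample n k m \<in> draws" "Sample n k m \<notin> hist n k"
    using assms by (auto simp: draws_def hist_def)
  have ins: "insert (Sample n k m) (hist n k) \<subseteq> hist n (Suc k)"
    using S(1) by (auto simp: hist_def split: draw.splits)
  note moments = noise_moments[OF hist_subset S L2_measurable_H[OF X], folded noise_def]
  show "L2 (hist n (Suc k)) (noise n k m)"
    using L2_mono[OF moments(1) ins hist_subset] .
  show "expectation (\<lambda>\<omega>. (norm (noise n k m \<omega>))\<^sup>2) \<le> \<sigma>\<^sup>2"
    by (rule moments(2))
  show "L2 (hist n k) Z \<Longrightarrow> expectation (\<lambda>\<omega>. Z \<omega> \<bullet> noise n k m \<omega>) = 0"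
    by (rule moments(3))
qed

lemma L2_draws: "L2 I X \<Longrightarrow> L2 draws X"
  using L2_mono L2_subset by blast

text \<open>Forgets which draws each quantity depends on, leaving the integrability facts that the
  expectation estimates require.\<close>

lemma L2_draws_run:
  assumes "n < N" "k \<le> K"
  shows "L2 draws (xt n)" "L2 draws (xb n k)" "L2 draws (\<lambda>\<omega>. gF (xb n k \<omega>))"
    and "m < M \<Longrightarrow> L2 draws (xl n k m)" "m < M \<Longrightarrow> L2 draws (\<lambda>\<omega>. gFw m (xl n k m \<omega>))"
    and "m < M \<Longrightarrow> L2 draws (\<lambda>\<omega>. xl n k m \<omega> - xt n \<omega>)" "m < M \<Longrightarrow> L2 draws (upd n m)"
    and "m < M \<Longrightarrow> k < K \<Longrightarrow> L2 draws (noise n k m)"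
proof -
  show xt: "L2 draws (xt n)" using assms by (intro L2_draws[OF L2_xt]) auto
  show xb: "L2 draws (xb n k)" using assms by (intro L2_draws[OF L2_xb] L2_xt) auto
  show "L2 draws (\<lambda>\<omega>. gF (xb n k \<omega>))" by (rule L2_lipschitz[OF xb objective_lipschitz])
  assume m: "m < M"
  show xl: "L2 draws (xl n k m)" using assms m by (intro L2_draws[OF L2_local] L2_xt) auto
  show "L2 draws (\<lambda>\<omega>. gFw m (xl n k m \<omega>))" by (rule L2_lipschitz[OF xl worker_lipschitz[OF m]])
  show "L2 draws (\<lambda>\<omega>. xl n k m \<omega> - xt n \<omega>)" by (rule L2_diff[OF xl xt])
  show "L2 draws (upd n m)" using assms m by (intro L2_draws[OF L2_upd] L2_xt) auto
  show "k < K \<Longrightarrow> L2 draws (noise n k m)" using assms m by (intro L2_draws[OF noise_sample(1)]) auto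
qed

lemma integrable_run [simp]:
  assumes "n < N" "k \<le> K"
  shows "integrable P (\<lambda>\<omega>. (norm (gF (xb n k \<omega>)))\<^sup>2)"
    and "m < M \<Longrightarrow> integrable P (\<lambda>\<omega>. (norm (gFw m (xl n k m \<omega>)))\<^sup>2)"
    and "m < M \<Longrightarrow> integrable P (\<lambda>\<omega>. (norm (xl n k m \<omega> - xt n \<omega>))\<^sup>2)"
    and "m < M \<Longrightarrow> k < K \<Longrightarrow> integrable P (\<lambda>\<omega>. (norm (noise n k m \<omega>))\<^sup>2)"
    and "integrable P (\<lambda>\<omega>. objective M D f (xb n k \<omega>))"
  by (rule L2_integrable[OF L2_draws_run(3)[OF assms]])
    (rule L2_integrable[OF L2_draws_run(5)[OF assms]] L2_integrable[OF L2_draws_run(6)[OF assms]]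
      L2_integrable[OF L2_draws_run(8)[OF assms]] integrable_objective[OF L2_draws_run(2)[OF assms]]; assumption)+

lemma integrable_upd [simp]: "n < N \<Longrightarrow> m < M \<Longrightarrow> integrable P (\<lambda>\<omega>. (norm (upd n m \<omega>))\<^sup>2)"
  by (rule L2_integrable[OF L2_draws_run(7)]) auto

lemma integrable_sum_workers [simp]:
  assumes "n < N" "k \<le> K"
  shows "integrable P (\<lambda>\<omega>. \<Sum>m<M. (norm (gFw m (xl n k m \<omega>)))\<^sup>2)"
    and "integrable P (\<lambda>\<omega>. \<Sum>m<M. (norm (xl n k m \<omega> - xt n \<omega>))\<^sup>2)"
    and "k < K \<Longrightarrow> integrable P (\<lambda>\<omega>. \<Sum>m<M. (norm (noise n k m \<omega>))\<^sup>2)"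
  by (rule Bochner_Integration.integrable_sum; use assms in simp)+

lemma integrable_sum_upd [simp]: "n < N \<Longrightarrow> integrable P (\<lambda>\<omega>. \<Sum>m<M. (norm (upd n m \<omega>))\<^sup>2)"
  by (rule Bochner_Integration.integrable_sum) simp

lemma integrable_sum_steps [simp]:
  "n < N \<Longrightarrow> m < M \<Longrightarrow> integrable P (\<lambda>\<omega>. \<Sum>l<K. (norm (gFw m (xl n l m \<omega>)))\<^sup>2)"
  by (rule Bochner_Integration.integrable_sum) simp

text \<open>\<open>A\<close> is the quantity that the rate concerns. \<open>R\<close> and
  \<open>V\<close> are auxiliary: \<open>V_le\<close> and \<open>R_le\<close> link them, and
  \<open>round_step\<close> eliminates both.\<close>

definition A where "A n k = expectation (\<lambda>\<omega>. (norm (gF (xb n k \<omega>)))\<^sup>2)"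
definition R where "R n k = (1 / real M) * (\<Sum>m<M. expectation (\<lambda>\<omega>. (norm (gFw m (xl n k m \<omega>)))\<^sup>2))"
definition V where "V n k = (1 / real M) * (\<Sum>m<M. expectation (\<lambda>\<omega>. (norm (xl n k m \<omega> - xt n \<omega>))\<^sup>2))"

lemma A_nonneg: "0 \<le> A n k" and R_nonneg: "0 \<le> R n k" and V_nonneg: "0 \<le> V n k"
  by (auto simp: A_def R_def V_def intro!: sum_nonneg divide_nonneg_nonneg)

lemma average_const: "(1 / real M) * (\<Sum>m<M. a) = (a :: real)"
  using M by simp

text \<open>The noise is summed by Cauchy-Schwarz, which gives
  \<open>K\<^sup>2 * \<sigma>\<^sup>2\<close>. This loss is affordable since \<open>V\<close> enters
  the descent with the further factor \<open>c * L\<^sup>2\<close>.\<close>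

lemma V_le:
  assumes n: "n < N" and k: "k \<le> K"
  shows "V n k \<le> 2 * c\<^sup>2 * real K * ((\<Sum>l<K. R n l) + real K * \<sigma>\<^sup>2)"
proof -
  have E: "expectation (\<lambda>\<omega>. (norm (xl n k m \<omega> - xt n \<omega>))\<^sup>2)
      \<le> 2 * c\<^sup>2 * real K * (\<Sum>l<K. expectation (\<lambda>\<omega>. (norm (gFw m (xl n l m \<omega>)))\<^sup>2) + \<sigma>\<^sup>2)" if m: "m < M" for m
  proof -
    let ?b = "\<lambda>l \<omega>. 2 * (norm (gFw m (xl n l m \<omega>)))\<^sup>2 + 2 * (norm (noise n l m \<omega>))\<^sup>2"
    have path: "(norm (xl n k m \<omega> - xt n \<omega>))\<^sup>2 \<le> c\<^sup>2 * (real K * (\<Sum>l<K. ?b l \<omega>))" for \<omega>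
    proof -
      have "(norm (xl n k m \<omega> - xt n \<omega>))\<^sup>2 = c\<^sup>2 * (norm (\<Sum>l<k. gFw m (xl n l m \<omega>) + noise n l m \<omega>))\<^sup>2"
        by (simp add: xl_sum[of n k] power_mult_distrib)
      also have "\<dots> \<le> c\<^sup>2 * (real k * (\<Sum>l<k. (norm (gFw m (xl n l m \<omega>) + noise n l m \<omega>))\<^sup>2))"
        using norm_sum_power2_le[of "{..<k}" "\<lambda>l. gFw m (xl n l m \<omega>) + noise n l m \<omega>"]
        by (intro mult_left_mono) simp_all
      also have "\<dots> \<le> c\<^sup>2 * (real K * (\<Sum>l<K. ?b l \<omega>))"
      proof (intro mult_left_mono mult_mono)
        have "(\<Sum>l<k. (norm (gFw m (xl n l m \<omega>) + noise n l m \<omega>))\<^sup>2) \<le> (\<Sum>l<k. ?b l \<omega>)"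
          by (intro sum_mono norm_add_power2_le)
        also have "\<dots> \<le> (\<Sum>l<K. ?b l \<omega>)"
          using k by (intro sum_mono2) auto
        finally show "(\<Sum>l<k. (norm (gFw m (xl n l m \<omega>) + noise n l m \<omega>))\<^sup>2) \<le> (\<Sum>l<K. ?b l \<omega>)" .
      qed (use k in \<open>auto intro: sum_nonneg\<close>)
      finally show ?thesis .
    qed
    have "expectation (\<lambda>\<omega>. (norm (xl n k m \<omega> - xt n \<omega>))\<^sup>2) \<le> expectation (\<lambda>\<omega>. c\<^sup>2 * (real K * (\<Sum>l<K. ?b l \<omega>)))"
      using n k m path by (intro integral_mono) auto
    also have "\<dots> = c\<^sup>2 * (real K * (\<Sum>l<K. 2 * expectation (\<lambda>\<omega>. (norm (gFw m (xl n l m \<omega>)))\<^sup>2) + 2 * expectation (\<lambda>\<omega>. (norm (noise n l m \<omega>))\<^sup>2)))"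
      using n m by (simp add: Bochner_Integration.integral_sum)
    also have "\<dots> \<le> c\<^sup>2 * (real K * (\<Sum>l<K. 2 * expectation (\<lambda>\<omega>. (norm (gFw m (xl n l m \<omega>)))\<^sup>2) + 2 * \<sigma>\<^sup>2))"
      using n m by (intro mult_left_mono sum_mono add_left_mono noise_sample(2)) auto
    also have "\<dots> = 2 * c\<^sup>2 * real K * (\<Sum>l<K. expectation (\<lambda>\<omega>. (norm (gFw m (xl n l m \<omega>)))\<^sup>2) + \<sigma>\<^sup>2)"
      by (simp add: sum_distrib_left algebra_simps sum.distrib)
    finally show ?thesis .
  qed
  have "V n k \<le> (1 / real M) * (\<Sum>m<M. 2 * c\<^sup>2 * real K * (\<Sum>l<K. expectation (\<lambda>\<omega>. (norm (gFw m (xl n l m \<omega>)))\<^sup>2) + \<sigma>\<^sup>2))"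
    unfolding V_def by (intro mult_left_mono sum_mono E) auto
  also have "\<dots> = 2 * c\<^sup>2 * real K * (\<Sum>l<K. (1 / real M) * (\<Sum>m<M. expectation (\<lambda>\<omega>. (norm (gFw m (xl n l m \<omega>)))\<^sup>2) + \<sigma>\<^sup>2))"
    unfolding sum_distrib_left[symmetric] sum.swap[of _ "{..<K}"] by simp
  also have "\<dots> = 2 * c\<^sup>2 * real K * (\<Sum>l<K. R n l + \<sigma>\<^sup>2)"
    unfolding sum.distrib distrib_left average_const R_def ..
  finally show ?thesis by (simp add: sum.distrib)
qed

text \<open>Pythagoras: the earlier noises are known when the next sample is drawn, so the cross
  term vanishes and the bound grows linearly in \<open>k\<close>.\<close>

lemma noise_sum_le:
  assumes n: "n < N" and m: "m < M" and k: "k \<le> K"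
  shows "L2 (hist n k) (\<lambda>\<omega>. \<Sum>l<k. noise n l m \<omega>) \<and>
    expectation (\<lambda>\<omega>. (norm (\<Sum>l<k. noise n l m \<omega>))\<^sup>2) \<le> real k * \<sigma>\<^sup>2"
  using k
proof (induction k)
  case 0
  then show ?case by (simp add: L2_const hist_subset)
next
  case (Suc k)
  let ?W = "\<lambda>\<omega>. \<Sum>l<k. noise n l m \<omega>"
  from Suc have k: "k < K" and W: "L2 (hist n k) ?W" and IH: "expectation (\<lambda>\<omega>. (norm (?W \<omega>))\<^sup>2) \<le> real k * \<sigma>\<^sup>2"
    by auto
  note \<eta> = noise_sample[OF n k m]
  have W': "L2 (hist n (Suc k)) ?W" by (rule L2_mono[OF W hist_mono hist_subset]) simp
  have "expectation (\<lambda>\<omega>. (norm (\<Sum>l<Suc k. noise n l m \<omega>))\<^sup>2) =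
      expectation (\<lambda>\<omega>. (norm (?W \<omega>))\<^sup>2 + 2 * (?W \<omega> \<bullet> noise n k m \<omega>) + (norm (noise n k m \<omega>))\<^sup>2)"
    by (simp add: power2_norm_eq_inner inner_add_left inner_add_right inner_commute algebra_simps)
  also have "\<dots> = expectation (\<lambda>\<omega>. (norm (?W \<omega>))\<^sup>2) + 2 * expectation (\<lambda>\<omega>. ?W \<omega> \<bullet> noise n k m \<omega>)
      + expectation (\<lambda>\<omega>. (norm (noise n k m \<omega>))\<^sup>2)"
    using L2_integrable[OF W] L2_integrable[OF \<eta>(1)] integrable_inner_L2[OF W \<eta>(1)] by simp
  also have "\<dots> \<le> real (Suc k) * \<sigma>\<^sup>2"
    using IH \<eta>(2) \<eta>(3)[OF W] by (simp add: algebra_simps)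
  finally show ?case using L2_add[OF W' \<eta>(1)] by simp
qed

text \<open>Same decomposition as for the drift, but with the noise kept as one sum, so that its
  part is \<open>K * \<sigma>\<^sup>2\<close>. This is the bound that the quantization error
  inherits.\<close>

lemma upd_le:
  assumes n: "n < N"
  shows "(1 / real M) * (\<Sum>m<M. expectation (\<lambda>\<omega>. (norm (upd n m \<omega>))\<^sup>2))
    \<le> 2 * c\<^sup>2 * real K * ((\<Sum>l<K. R n l) + \<sigma>\<^sup>2)"
proof -
  have E: "expectation (\<lambda>\<omega>. (norm (upd n m \<omega>))\<^sup>2)
      \<le> 2 * c\<^sup>2 * real K * ((\<Sum>l<K. expectation (\<lambda>\<omega>. (norm (gFw m (xl n l m \<omega>)))\<^sup>2)) + \<sigma>\<^sup>2)" if m: "m < M" for m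
  proof -
    let ?g = "\<lambda>l \<omega>. gFw m (xl n l m \<omega>)" and ?W = "\<lambda>\<omega>. \<Sum>l<K. noise n l m \<omega>"
    have W: "integrable P (\<lambda>\<omega>. (norm (?W \<omega>))\<^sup>2)" "expectation (\<lambda>\<omega>. (norm (?W \<omega>))\<^sup>2) \<le> real K * \<sigma>\<^sup>2"
      using noise_sum_le[OF n m order_refl] L2_integrable by auto
    have path: "(norm (upd n m \<omega>))\<^sup>2 \<le> c\<^sup>2 * (2 * (real K * (\<Sum>l<K. (norm (?g l \<omega>))\<^sup>2)) + 2 * (norm (?W \<omega>))\<^sup>2)" for \<omega>
    proof -
      have "(norm (upd n m \<omega>))\<^sup>2 = c\<^sup>2 * (norm ((\<Sum>l<K. ?g l \<omega>) + ?W \<omega>))\<^sup>2"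
        by (simp add: upd_def xl_sum[of n K] power_mult_distrib sum.distrib)
      also have "\<dots> \<le> c\<^sup>2 * (2 * (norm (\<Sum>l<K. ?g l \<omega>))\<^sup>2 + 2 * (norm (?W \<omega>))\<^sup>2)"
        by (intro mult_left_mono norm_add_power2_le) simp
      also have "\<dots> \<le> c\<^sup>2 * (2 * (real K * (\<Sum>l<K. (norm (?g l \<omega>))\<^sup>2)) + 2 * (norm (?W \<omega>))\<^sup>2)"
        using norm_sum_power2_le[of "{..<K}" "\<lambda>l. ?g l \<omega>"] by (intro mult_left_mono add_right_mono) auto
      finally show ?thesis .
    qed
    have "expectation (\<lambda>\<omega>. (norm (upd n m \<omega>))\<^sup>2)
        \<le> expectation (\<lambda>\<omega>. c\<^sup>2 * (2 * (real K * (\<Sum>l<K. (norm (?g l \<omega>))\<^sup>2)) + 2 * (norm (?W \<omega>))\<^sup>2))"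
      using n m path W(1) by (intro integral_mono) auto
    also have "\<dots> = c\<^sup>2 * (2 * (real K * (\<Sum>l<K. expectation (\<lambda>\<omega>. (norm (?g l \<omega>))\<^sup>2))) + 2 * expectation (\<lambda>\<omega>. (norm (?W \<omega>))\<^sup>2))"
      using n m W(1) by (simp add: Bochner_Integration.integral_sum)
    also have "\<dots> \<le> c\<^sup>2 * (2 * (real K * (\<Sum>l<K. expectation (\<lambda>\<omega>. (norm (?g l \<omega>))\<^sup>2))) + 2 * (real K * \<sigma>\<^sup>2))"
      using W(2) by (intro mult_left_mono add_left_mono) auto
    finally show ?thesis by (simp add: algebra_simps)
  qed
  have "(1 / real M) * (\<Sum>m<M. expectation (\<lambda>\<omega>. (norm (upd n m \<omega>))\<^sup>2))
      \<le> (1 / real M) * (\<Sum>m<M. 2 * c\<^sup>2 * real K * ((\<Sum>l<K. expectation (\<lambda>\<omega>. (norm (gFw m (xl n l m \<omega>)))\<^sup>2)) + \<sigma>\<^sup>2))"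
    by (intro mult_left_mono sum_mono E) auto
  also have "\<dots> = 2 * c\<^sup>2 * real K * ((1 / real M) * (\<Sum>m<M. (\<Sum>l<K. expectation (\<lambda>\<omega>. (norm (gFw m (xl n l m \<omega>)))\<^sup>2)) + \<sigma>\<^sup>2))"
    unfolding sum_distrib_left[symmetric] by simp
  also have "\<dots> = 2 * c\<^sup>2 * real K * ((\<Sum>l<K. R n l) + \<sigma>\<^sup>2)"
    unfolding sum.distrib distrib_left average_const R_def sum_distrib_left[symmetric] sum.swap[of _ "{..<K}"] by simp
  finally show ?thesis .
qed

text \<open>Both points are compared with the start of the round, and the average moves no more than
  its members do in mean square; hence the factor \<open>2 + 2\<close>.\<close>

lemma drift_average_le:
  "(1 / real M) * (\<Sum>m<M. (norm (xb n k \<omega> - xl n k m \<omega>))\<^sup>2)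
    \<le> 4 * ((1 / real M) * (\<Sum>m<M. (norm (xl n k m \<omega> - xt n \<omega>))\<^sup>2))"
proof -
  let ?v = "(1 / real M) * (\<Sum>m<M. (norm (xl n k m \<omega> - xt n \<omega>))\<^sup>2)"
  have "xb n k \<omega> - xt n \<omega> = (1 / real M) *\<^sub>R (\<Sum>m<M. xl n k m \<omega> - xt n \<omega>)"
    using M by (simp add: xb_def sum_subtractf sum_constant_scaleR scaleR_diff_right del: sum_constant)
  then have b: "(norm (xb n k \<omega> - xt n \<omega>))\<^sup>2 \<le> ?v"
    using norm_average_power2_le[OF M] by simp
  have "(norm (xb n k \<omega> - xl n k m \<omega>))\<^sup>2 \<le> 2 * (norm (xb n k \<omega> - xt n \<omega>))\<^sup>2 + 2 * (norm (xl n k m \<omega> - xt n \<omega>))\<^sup>2" for m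
    using norm_diff_power2_le[of "xb n k \<omega> - xt n \<omega>" "xl n k m \<omega> - xt n \<omega>"] by simp
  then have "(1 / real M) * (\<Sum>m<M. (norm (xb n k \<omega> - xl n k m \<omega>))\<^sup>2)
      \<le> (1 / real M) * (\<Sum>m<M. 2 * ?v + 2 * (norm (xl n k m \<omega> - xt n \<omega>))\<^sup>2)"
    using b by (intro mult_left_mono sum_mono) (smt (verit), simp)
  also have "\<dots> = 2 * ?v + 2 * ?v"
    unfolding sum.distrib distrib_left average_const sum_distrib_left[symmetric] by simp
  finally show ?thesis by simp
qed

text \<open>A local gradient is split into three: its change between the local and the average
  iterate, the heterogeneity at the average, and the gradient of the objective there. The
  coefficient 12 is \<open>3 * 4\<close>, from this split and
  \<open>drift_average_le\<close>.\<close>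

lemma gradient_average_le:
  "(1 / real M) * (\<Sum>m<M. (norm (gFw m (xl n k m \<omega>)))\<^sup>2)
    \<le> 12 * L\<^sup>2 * ((1 / real M) * (\<Sum>m<M. (norm (xl n k m \<omega> - xt n \<omega>))\<^sup>2)) + 3 * \<kappa>\<^sup>2 + 3 * (norm (gF (xb n k \<omega>)))\<^sup>2"
proof -
  let ?b = "xb n k \<omega>"
  have "(norm (gFw m (xl n k m \<omega>)))\<^sup>2 \<le> 3 * (L\<^sup>2 * (norm (?b - xl n k m \<omega>))\<^sup>2) + 3 * (norm (gF ?b - gFw m ?b))\<^sup>2 + 3 * (norm (gF ?b))\<^sup>2"
    if m: "m < M" for m
  proof -
    let ?a = "\<lambda>i :: nat. if i = 0 then gFw m (xl n k m \<omega>) - gFw m ?b else if i = 1 then gFw m ?b - gF ?b else gF ?b"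
    have "(norm (gFw m (xl n k m \<omega>)))\<^sup>2 \<le> 3 * (norm (gFw m (xl n k m \<omega>) - gFw m ?b))\<^sup>2 + 3 * (norm (gFw m ?b - gF ?b))\<^sup>2 + 3 * (norm (gF ?b))\<^sup>2"
      using norm_sum_power2_le[of "{0, 1, 2 :: nat}" ?a] by simp
    moreover have "(norm (gFw m (xl n k m \<omega>) - gFw m ?b))\<^sup>2 \<le> L\<^sup>2 * (norm (?b - xl n k m \<omega>))\<^sup>2"
      unfolding power_mult_distrib[symmetric] using norm_worker_diff[OF m]
      by (intro power_mono) (simp_all add: norm_minus_commute)
    ultimately show ?thesis by (simp add: norm_minus_commute)
  qed
  then have "(1 / real M) * (\<Sum>m<M. (norm (gFw m (xl n k m \<omega>)))\<^sup>2)
    \<le> (1 / real M) * (\<Sum>m<M. 3 * (L\<^sup>2 * (norm (?b - xl n k m \<omega>))\<^sup>2) + 3 * (norm (gF ?b - gFw m ?b))\<^sup>2 + 3 * (norm (gF ?b))\<^sup>2)"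
    by (intro mult_left_mono sum_mono) auto
  also have "\<dots> = 3 * L\<^sup>2 * ((1 / real M) * (\<Sum>m<M. (norm (?b - xl n k m \<omega>))\<^sup>2)) + 3 * ((1 / real M) * (\<Sum>m<M. (norm (gF ?b - gFw m ?b))\<^sup>2)) + 3 * (norm (gF ?b))\<^sup>2"
    unfolding sum.distrib distrib_left average_const sum_distrib_left[symmetric] by (simp only: mult.left_commute mult.assoc average_const)
  also have "\<dots> \<le> 3 * L\<^sup>2 * (4 * ((1 / real M) * (\<Sum>m<M. (norm (xl n k m \<omega> - xt n \<omega>))\<^sup>2))) + 3 * \<kappa>\<^sup>2 + 3 * (norm (gF ?b))\<^sup>2"
    using variance by (intro add_mono mult_left_mono drift_average_le) (auto simp: bounded_variance_def)
  finally show ?thesis by simp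
qed

lemma R_le:
  assumes n: "n < N" and k: "k \<le> K"
  shows "R n k \<le> 12 * L\<^sup>2 * V n k + 3 * \<kappa>\<^sup>2 + 3 * A n k"
proof -
  have "expectation (\<lambda>\<omega>. (1 / real M) * (\<Sum>m<M. (norm (gFw m (xl n k m \<omega>)))\<^sup>2)) \<le>
    expectation (\<lambda>\<omega>. 12 * L\<^sup>2 * ((1 / real M) * (\<Sum>m<M. (norm (xl n k m \<omega> - xt n \<omega>))\<^sup>2)) + 3 * \<kappa>\<^sup>2 + 3 * (norm (gF (xb n k \<omega>)))\<^sup>2)"
    using n k by (intro integral_mono gradient_average_le) auto
  then show ?thesis
    using n k by (simp add: R_def V_def A_def Bochner_Integration.integral_sum prob_space)
qed

text \<open>Descent of the average iterate. Polarization of \<open>p \<bullet> a\<close>, for the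
  true gradient \<open>p\<close> and the averaged local gradient \<open>a\<close>, yields half of
  each squared norm minus half of their squared distance; the distance is paid by drift, and the
  noise has no first-order effect in expectation.\<close>

lemma local_step:
  assumes n: "n < N" and k: "k < K" and cL: "4 * c * L \<le> 1"
  shows "expectation (\<lambda>\<omega>. objective M D f (xb n (Suc k) \<omega>)) \<le>
    expectation (\<lambda>\<omega>. objective M D f (xb n k \<omega>)) - c / 2 * A n k + 2 * c * L\<^sup>2 * V n k + 2 * L * c\<^sup>2 * \<sigma>\<^sup>2"
proof -
  let ?F = "objective M D f"
  let ?v = "\<lambda>\<omega>. (1 / real M) * (\<Sum>m<M. (norm (xl n k m \<omega> - xt n \<omega>))\<^sup>2)"
  let ?q = "\<lambda>\<omega>. (1 / real M) * (\<Sum>m<M. (norm (noise n k m \<omega>))\<^sup>2)"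
  let ?i = "\<lambda>\<omega>. (1 / real M) * (\<Sum>m<M. gF (xb n k \<omega>) \<bullet> noise n k m \<omega>)"
  let ?B = "\<lambda>\<omega>. ?F (xb n k \<omega>) - c / 2 * (norm (gF (xb n k \<omega>)))\<^sup>2 + 2 * c * L\<^sup>2 * ?v \<omega> - c * ?i \<omega> + 2 * L * c\<^sup>2 * ?q \<omega>"
  have path: "?F (xb n (Suc k) \<omega>) \<le> ?B \<omega>" for \<omega>
  proof -
    let ?b = "xb n k \<omega>"
    define p where "p = gF ?b"
    define a where "a = (1 / real M) *\<^sub>R (\<Sum>m<M. gFw m (xl n k m \<omega>))"
    define e where "e = (1 / real M) *\<^sub>R (\<Sum>m<M. noise n k m \<omega>)"
    have b': "xb n (Suc k) \<omega> - ?b = - (c *\<^sub>R (a + e))"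
      by (simp add: xb_Suc a_def e_def)
    have nb: "(norm (xb n (Suc k) \<omega> - ?b))\<^sup>2 = c\<^sup>2 * (norm (a + e))\<^sup>2"
      by (simp only: b' norm_minus_cancel norm_scaleR power_mult_distrib power2_abs)
    have "p - a = (1 / real M) *\<^sub>R (\<Sum>m<M. gFw m ?b - gFw m (xl n k m \<omega>))"
      by (simp add: p_def a_def objective_grad sum_subtractf scaleR_diff_right)
    then have "(norm (p - a))\<^sup>2 \<le> (1 / real M) * (\<Sum>m<M. (norm (gFw m ?b - gFw m (xl n k m \<omega>)))\<^sup>2)"
      using norm_average_power2_le[OF M] by simp
    also have "\<dots> \<le> (1 / real M) * (\<Sum>m<M. L\<^sup>2 * (norm (?b - xl n k m \<omega>))\<^sup>2)"
      unfolding power_mult_distrib[symmetric]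
      by (intro mult_left_mono sum_mono power_mono norm_worker_diff) auto
    also have "\<dots> = L\<^sup>2 * ((1 / real M) * (\<Sum>m<M. (norm (?b - xl n k m \<omega>))\<^sup>2))"
      unfolding sum_distrib_left[symmetric] by simp
    also have "\<dots> \<le> L\<^sup>2 * (4 * ?v \<omega>)"
      by (intro mult_left_mono drift_average_le) simp
    finally have pa: "(norm (p - a))\<^sup>2 \<le> 4 * L\<^sup>2 * ?v \<omega>" by (simp add: mult_ac)
    have e: "(norm e)\<^sup>2 \<le> ?q \<omega>"
      unfolding e_def by (rule norm_average_power2_le[OF M])
    have pe: "p \<bullet> e = ?i \<omega>"
      by (simp add: p_def e_def inner_sum_right)
    have id: "(norm (p - a))\<^sup>2 = (norm p)\<^sup>2 - 2 * (p \<bullet> a) + (norm a)\<^sup>2"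
      by (simp add: power2_norm_eq_inner inner_diff_left inner_diff_right inner_commute)
    have "?F (xb n (Suc k) \<omega>) \<le> ?F ?b + p \<bullet> (xb n (Suc k) \<omega> - ?b) + L * (norm (xb n (Suc k) \<omega> - ?b))\<^sup>2"
      using mean_value_gradient[OF objective_differentiable objective_lipschitz, of "xb n (Suc k) \<omega>" ?b]
      by (auto simp: p_def)
    also have "\<dots> = ?F ?b - c * (p \<bullet> a) - c * (p \<bullet> e) + L * c\<^sup>2 * (norm (a + e))\<^sup>2"
      unfolding nb unfolding b' by (simp add: inner_add_right algebra_simps)
    also have "\<dots> \<le> ?F ?b - c * (p \<bullet> a) - c * (p \<bullet> e) + L * c\<^sup>2 * (2 * (norm a)\<^sup>2 + 2 * (norm e)\<^sup>2)"
      using L by (intro add_left_mono mult_left_mono norm_add_power2_le) simp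
    also have "\<dots> = ?F ?b - c / 2 * (norm p)\<^sup>2 + c / 2 * (norm (p - a))\<^sup>2 - c * (p \<bullet> e) + 2 * L * c\<^sup>2 * (norm e)\<^sup>2
        + (2 * L * c\<^sup>2 - c / 2) * (norm a)\<^sup>2"
      unfolding id by (simp add: algebra_simps)
    also have "\<dots> \<le> ?F ?b - c / 2 * (norm p)\<^sup>2 + c / 2 * (4 * L\<^sup>2 * ?v \<omega>) - c * (p \<bullet> e) + 2 * L * c\<^sup>2 * ?q \<omega> + 0"
    proof (intro add_mono diff_mono mult_left_mono pa e)
      \<comment> \<open>The condition \<open>4 * c * L \<le> 1\<close> lets the negative square of
        \<open>a\<close> from polarization absorb the second-order term.\<close>
      have "2 * L * c\<^sup>2 - c / 2 = c / 2 * (4 * c * L - 1)"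
        by (simp add: power2_eq_square algebra_simps)
      also have "\<dots> \<le> 0" using cL c by (intro mult_nonneg_nonpos) auto
      finally show "(2 * L * c\<^sup>2 - c / 2) * (norm a)\<^sup>2 \<le> 0" by (intro mult_nonpos_nonneg) auto
    qed (use L c in auto)
    finally show ?thesis unfolding pe unfolding p_def by (simp add: mult_ac)
  qed
  have gh: "L2 (hist n k) (\<lambda>\<omega>. gF (xb n k \<omega>))"
    using n k by (intro L2_lipschitz[OF L2_xb objective_lipschitz] L2_xt) auto
  have ii: "integrable P (\<lambda>\<omega>. gF (xb n k \<omega>) \<bullet> noise n k m \<omega>)" "expectation (\<lambda>\<omega>. gF (xb n k \<omega>) \<bullet> noise n k m \<omega>) = 0" if "m < M" for m
    using integrable_inner_L2[OF gh noise_sample(1)[OF n k that]] noise_sample(3)[OF n k that gh] by auto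
  have isum: "integrable P (\<lambda>\<omega>. \<Sum>m<M. gF (xb n k \<omega>) \<bullet> noise n k m \<omega>)"
    by (intro Bochner_Integration.integrable_sum ii) simp
  have "expectation (\<lambda>\<omega>. ?F (xb n (Suc k) \<omega>)) \<le> expectation ?B"
    using n k path isum by (intro integral_mono) auto
  also have "\<dots> = expectation (\<lambda>\<omega>. ?F (xb n k \<omega>)) - c / 2 * A n k + 2 * c * L\<^sup>2 * V n k
      + 2 * L * c\<^sup>2 * ((1 / real M) * (\<Sum>m<M. expectation (\<lambda>\<omega>. (norm (noise n k m \<omega>))\<^sup>2)))"
    using n k ii isum by (simp add: A_def V_def Bochner_Integration.integral_sum)
  also have "\<dots> \<le> expectation (\<lambda>\<omega>. ?F (xb n k \<omega>)) - c / 2 * A n k + 2 * c * L\<^sup>2 * V n k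
      + 2 * L * c\<^sup>2 * ((1 / real M) * (\<Sum>m<M. \<sigma>\<^sup>2))"
    using L n k by (intro add_left_mono mult_left_mono sum_mono noise_sample(2)) auto
  finally show ?thesis unfolding average_const .
qed

text \<open>The gradient at the average iterate is known before the seeds of the round are drawn, so
  the linear term vanishes; the quadratic one is bounded through the local updates.\<close>

lemma communication_step:
  assumes n: "n < N"
  shows "expectation (\<lambda>\<omega>. objective M D f (xt (Suc n) \<omega>)) \<le>
    expectation (\<lambda>\<omega>. objective M D f (xb n K \<omega>)) + 2 * L * quant_const CARD('d) * c\<^sup>2 * real K * ((\<Sum>l<K. R n l) + \<sigma>\<^sup>2)"
proof -
  let ?F = "objective M D f"
  let ?q = "\<lambda>\<omega>. (1 / real M) * (\<Sum>m<M. (norm (upd n m \<omega>))\<^sup>2)"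
  have X: "L2 (hist n 0) (xt n)" using n by (intro L2_xt) auto
  have gh: "L2 (hist n K) (\<lambda>\<omega>. gF (xb n K \<omega>))"
    using n by (intro L2_lipschitz[OF L2_xb objective_lipschitz] X) auto
  have path: "?F (xt (Suc n) \<omega>) \<le> ?F (xb n K \<omega>) - gF (xb n K \<omega>) \<bullet> qerr n \<omega> + L * (quant_const CARD('d) * ?q \<omega>)" for \<omega>
  proof -
    have "?F (xt (Suc n) \<omega>) \<le> ?F (xb n K \<omega>) - gF (xb n K \<omega>) \<bullet> qerr n \<omega> + L * (norm (qerr n \<omega>))\<^sup>2"
      using mean_value_gradient[OF objective_differentiable objective_lipschitz, of "xt (Suc n) \<omega>" "xb n K \<omega>"]
      by (auto simp: xt_Suc)
    then show ?thesis
      using mult_left_mono[OF qerr_norm_le[of n \<omega>], of L] L by linarith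
  qed
  have "expectation (\<lambda>\<omega>. ?F (xt (Suc n) \<omega>)) \<le>
      expectation (\<lambda>\<omega>. ?F (xb n K \<omega>) - gF (xb n K \<omega>) \<bullet> qerr n \<omega> + L * (quant_const CARD('d) * ?q \<omega>))"
    using n path integrable_inner_L2[OF gh qerr_L2(1)[OF n X]]
    by (intro integral_mono integrable_objective[OF L2_xt]) auto
  also have "\<dots> = expectation (\<lambda>\<omega>. ?F (xb n K \<omega>)) + L * (quant_const CARD('d) * ((1 / real M) * (\<Sum>m<M. expectation (\<lambda>\<omega>. (norm (upd n m \<omega>))\<^sup>2))))"
    using n integrable_inner_L2[OF gh qerr_L2(1)[OF n X]] qerr_L2(2)[OF n X gh]
    by (simp add: Bochner_Integration.integral_sum)
  also have "\<dots> \<le> expectation (\<lambda>\<omega>. ?F (xb n K \<omega>)) + L * (quant_const CARD('d) * (2 * c\<^sup>2 * real K * ((\<Sum>l<K. R n l) + \<sigma>\<^sup>2)))"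
    using L by (intro add_left_mono mult_left_mono upd_le[OF n]) (auto simp: quant_const_def)
  finally show ?thesis by (simp add: mult_ac)
qed

section \<open>Summation over steps and rounds\<close>

lemma local_steps:
  assumes n: "n < N" and cL: "4 * c * L \<le> 1"
  shows "expectation (\<lambda>\<omega>. objective M D f (xb n K \<omega>)) \<le> expectation (\<lambda>\<omega>. objective M D f (xt n \<omega>))
    - c / 2 * (\<Sum>k<K. A n k) + 2 * c * L\<^sup>2 * (\<Sum>k<K. V n k) + real K * (2 * L * c\<^sup>2 * \<sigma>\<^sup>2)"
proof -
  have "k \<le> K \<Longrightarrow> expectation (\<lambda>\<omega>. objective M D f (xb n k \<omega>)) \<le> expectation (\<lambda>\<omega>. objective M D f (xt n \<omega>))
    - c / 2 * (\<Sum>l<k. A n l) + 2 * c * L\<^sup>2 * (\<Sum>l<k. V n l) + real k * (2 * L * c\<^sup>2 * \<sigma>\<^sup>2)" for k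
  proof (induction k)
    case (Suc k)
    then show ?case
      using local_step[OF n _ cL, of k] by (simp add: algebra_simps)
  qed (simp add: xb_0)
  then show ?thesis by simp
qed

text \<open>The number 96 in \<open>small\<close> is \<open>12 * 8\<close>: the communication term
  carries \<open>12 * (B * (x * y))\<close> and may spend one eighth of \<open>c * SA\<close>. The
  square of \<open>K\<close> there serves the noise inside the drift, whose coefficient is
  proportional to \<open>x\<^sup>2 * y\<close>.\<close>

lemma round_step:
  assumes n: "n < N" and K: "K \<ge> 1" and \<kappa>: "real K * \<kappa>\<^sup>2 \<le> 2 * \<sigma>\<^sup>2"
    and small: "96 * quant_const CARD('d) * (real K)\<^sup>2 * (c * L) \<le> 1"
  shows "expectation (\<lambda>\<omega>. objective M D f (xt (Suc n) \<omega>)) \<le> expectation (\<lambda>\<omega>. objective M D f (xt n \<omega>))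
    - c / 4 * (\<Sum>k<K. A n k) + (16 + 28 * quant_const CARD('d)) * (real K * (L * c\<^sup>2 * \<sigma>\<^sup>2))"
proof -
  define B where "B = quant_const CARD('d)"
  define x where "x = real K"
  define y where "y = c * L"
  define SA SR SV where "SA = (\<Sum>k<K. A n k)" and "SR = (\<Sum>k<K. R n k)" and "SV = (\<Sum>k<K. V n k)"
  have nonneg: "0 \<le> SA" "0 \<le> SR" "0 \<le> SV"
    by (auto simp: SA_def SR_def SV_def intro!: sum_nonneg A_nonneg R_nonneg V_nonneg)
  have x: "1 \<le> x" and y: "0 < y" using K c L by (auto simp: x_def y_def)
  have B: "1 \<le> B"
  proof -
    have d: "1 \<le> real CARD('d)" using zero_less_card_finite[where 'a = 'd] by linarith
    have "1 * 1 \<le> (real CARD('d) ^ CARD('d) + 1) * real CARD('d)"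
      using d by (intro mult_mono) auto
    then show ?thesis unfolding B_def quant_const_def by (intro one_le_power) simp
  qed
  have x2: "x \<le> x\<^sup>2" using mult_left_mono[OF x, of x] x by (simp add: power2_eq_square)
  have w: "96 * (x\<^sup>2 * y) \<le> 1"
  proof -
    have "1 * (96 * (x\<^sup>2 * y)) \<le> B * (96 * (x\<^sup>2 * y))" using B y by (intro mult_right_mono) auto
    also have "\<dots> \<le> 1" using small by (simp add: B_def x_def y_def mult_ac)
    finally show ?thesis by simp
  qed
  have xy: "96 * (x * y) \<le> 1"
    using mult_right_mono[OF x2, of y] w y by linarith
  have y1: "96 * y \<le> 1"
    using mult_right_mono[OF x, of y] xy y by linarith
  have Bxy: "96 * (B * (x * y)) \<le> 1"
  proof -
    have "B * (x * y) \<le> B * (x\<^sup>2 * y)" using x2 B y by (intro mult_left_mono mult_right_mono) auto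
    then show ?thesis using small by (simp add: B_def x_def y_def mult_ac)
  qed
  have SV: "SV \<le> 2 * c\<^sup>2 * x\<^sup>2 * (SR + x * \<sigma>\<^sup>2)"
  proof -
    have "SV \<le> (\<Sum>k<K. 2 * c\<^sup>2 * real K * (SR + real K * \<sigma>\<^sup>2))"
      unfolding SV_def SR_def by (intro sum_mono V_le[OF n]) auto
    then show ?thesis by (simp add: x_def power2_eq_square mult_ac)
  qed
  have "SR \<le> (\<Sum>k<K. 12 * L\<^sup>2 * V n k + 3 * \<kappa>\<^sup>2 + 3 * A n k)"
    unfolding SR_def by (intro sum_mono R_le[OF n]) auto
  also have "\<dots> = 12 * L\<^sup>2 * SV + 3 * (x * \<kappa>\<^sup>2) + 3 * SA"
    by (simp add: sum.distrib SV_def SA_def x_def flip: sum_distrib_left)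
  also have "\<dots> \<le> 12 * L\<^sup>2 * (2 * c\<^sup>2 * x\<^sup>2 * (SR + x * \<sigma>\<^sup>2)) + 6 * \<sigma>\<^sup>2 + 3 * SA"
    using \<kappa> by (intro add_mono mult_left_mono SV) (auto simp: x_def)
  also have "\<dots> = 24 * (x * y)\<^sup>2 * SR + 24 * (x * y) * (x\<^sup>2 * y) * \<sigma>\<^sup>2 + 6 * \<sigma>\<^sup>2 + 3 * SA"
    by (simp add: y_def power_mult_distrib algebra_simps power2_eq_square)
  \<comment> \<open>Closing the circle: small coefficients leave at most half of \<open>SR\<close>
    on the right.\<close>
  also have "\<dots> \<le> 1 / 2 * SR + 1 / 2 * \<sigma>\<^sup>2 + 6 * \<sigma>\<^sup>2 + 3 * SA"
  proof (intro add_mono mult_right_mono)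
    have "(x * y) * (x * y) \<le> (1 / 96) * (1 / 96)" using xy x y by (intro mult_mono) auto
    then show "24 * (x * y)\<^sup>2 \<le> 1 / 2" by (simp add: power2_eq_square)
    have "(x * y) * (x\<^sup>2 * y) \<le> (1 / 96) * (1 / 96)" using xy w x y by (intro mult_mono) auto
    then show "24 * (x * y) * (x\<^sup>2 * y) \<le> 1 / 2" by simp
  qed (use nonneg in auto)
  \<comment> \<open>Moving that half to the left doubles the remaining \<open>13 / 2\<close> and
    3.\<close>
  finally have SR: "SR \<le> 13 * \<sigma>\<^sup>2 + 6 * SA" by simp
  have x\<sigma>: "\<sigma>\<^sup>2 \<le> x * \<sigma>\<^sup>2" using mult_right_mono[OF x, of "\<sigma>\<^sup>2"] by simp
  have drift: "2 * c * L\<^sup>2 * SV \<le> c / 8 * SA + 14 * (x * (L * c\<^sup>2 * \<sigma>\<^sup>2))"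
  proof -
    have "2 * c * L\<^sup>2 * SV \<le> 2 * c * L\<^sup>2 * (2 * c\<^sup>2 * x\<^sup>2 * (SR + x * \<sigma>\<^sup>2))"
      using c by (intro mult_left_mono SV) auto
    also have "\<dots> \<le> 2 * c * L\<^sup>2 * (2 * c\<^sup>2 * x\<^sup>2 * (14 * (x * \<sigma>\<^sup>2) + 6 * SA))"
      using c SR x\<sigma> by (intro mult_left_mono) auto
    also have "\<dots> = (24 * (x * y)\<^sup>2) * (c * SA) + (4 * (x\<^sup>2 * y)) * (14 * (x * (L * c\<^sup>2 * \<sigma>\<^sup>2)))"
      by (simp add: y_def power_mult_distrib algebra_simps power2_eq_square)
    also have "\<dots> \<le> (1 / 8) * (c * SA) + 1 * (14 * (x * (L * c\<^sup>2 * \<sigma>\<^sup>2)))"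
    proof (intro add_mono mult_right_mono)
      have "(x * y) * (x * y) \<le> (1 / 96) * (1 / 96)" using xy x y by (intro mult_mono) auto
      then show "24 * (x * y)\<^sup>2 \<le> 1 / 8" by (simp add: power2_eq_square)
      have "0 \<le> x\<^sup>2 * y" using y by simp
      then show "4 * (x\<^sup>2 * y) \<le> 1" using w by linarith
    qed (use c L x nonneg in auto)
    finally show ?thesis by simp
  qed
  have comm: "2 * L * B * c\<^sup>2 * x * (SR + \<sigma>\<^sup>2) \<le> c / 8 * SA + 28 * B * (x * (L * c\<^sup>2 * \<sigma>\<^sup>2))"
  proof -
    have "2 * L * B * c\<^sup>2 * x * (SR + \<sigma>\<^sup>2) \<le> 2 * L * B * c\<^sup>2 * x * (14 * \<sigma>\<^sup>2 + 6 * SA)"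
      using L B c x SR by (intro mult_left_mono) auto
    also have "\<dots> = 12 * (B * (x * y)) * (c * SA) + 28 * B * (x * (L * c\<^sup>2 * \<sigma>\<^sup>2))"
      by (simp add: y_def algebra_simps power2_eq_square)
    also have "\<dots> \<le> (1 / 8) * (c * SA) + 28 * B * (x * (L * c\<^sup>2 * \<sigma>\<^sup>2))"
      using Bxy c nonneg by (intro add_right_mono mult_right_mono) auto
    finally show ?thesis by simp
  qed
  have "4 * c * L \<le> 1" using y1 y by (simp add: y_def)
  note local_steps[OF n this]
  then have "expectation (\<lambda>\<omega>. objective M D f (xt (Suc n) \<omega>)) \<le> expectation (\<lambda>\<omega>. objective M D f (xt n \<omega>))
      - c / 2 * SA + 2 * c * L\<^sup>2 * SV + 2 * (x * (L * c\<^sup>2 * \<sigma>\<^sup>2)) + 2 * L * B * c\<^sup>2 * x * (SR + \<sigma>\<^sup>2)"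
    using communication_step[OF n] by (simp add: B_def x_def SA_def SR_def SV_def mult_ac)
  \<comment> \<open>Of the gain \<open>c / 2\<close>, drift and communication consume
    \<open>c / 8\<close> each, leaving \<open>c / 4\<close>; the noise coefficient is
    \<open>2 + 14\<close> from the local steps plus \<open>28 * B\<close> from
    communication.\<close>
  then show ?thesis
    using drift comm unfolding B_def[symmetric] x_def[symmetric] SA_def[symmetric]
    by (simp add: algebra_simps)
qed

text \<open>Telescoping over the rounds; the final expected objective is at least the optimal value,
  so the initial gap pays for the summed gradients.\<close>

lemma ergodic_bound:
  assumes K: "K \<ge> 1" and N: "N \<ge> 1" and \<kappa>: "real K * \<kappa>\<^sup>2 \<le> 2 * \<sigma>\<^sup>2"
    and small: "96 * quant_const CARD('d) * (real K)\<^sup>2 * (c * L) \<le> 1"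
  shows "1 / (real N * real K) * (\<Sum>n<N. \<Sum>k<K. A n k) \<le>
    4 * (objective M D f x1 - optimal_value M D f) / (c * (real N * real K))
      + 4 * (16 + 28 * quant_const CARD('d)) * (c * L * \<sigma>\<^sup>2)"
proof -
  let ?Q = "16 + 28 * quant_const CARD('d)" and ?T = "real K * (L * c\<^sup>2 * \<sigma>\<^sup>2)"
  let ?S = "\<Sum>n<N. \<Sum>k<K. A n k"
  have "n \<le> N \<Longrightarrow> expectation (\<lambda>\<omega>. objective M D f (xt n \<omega>)) \<le> objective M D f x1
      - c / 4 * (\<Sum>i<n. \<Sum>k<K. A i k) + real n * (?Q * ?T)" for n
  proof (induction n)
    case 0
    then show ?case by (simp add: xt_0 prob_space)
  next
    case (Suc n)
    then show ?case
      using round_step[OF _ K \<kappa> small, of n] by (simp add: algebra_simps)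
  qed
  from this[OF order_refl] have "expectation (\<lambda>\<omega>. objective M D f (xt N \<omega>)) \<le>
      objective M D f x1 - c / 4 * ?S + real N * (?Q * ?T)" .
  moreover have "optimal_value M D f \<le> expectation (\<lambda>\<omega>. objective M D f (xt N \<omega>))"
  proof -
    have "optimal_value M D f \<le> objective M D f x" for x
      unfolding optimal_value_def using problem by (intro cINF_lower) (auto simp: stochastic_problem_def)
    then have "expectation (\<lambda>\<omega>. optimal_value M D f) \<le> expectation (\<lambda>\<omega>. objective M D f (xt N \<omega>))"
      by (intro integral_mono integrable_objective[OF L2_xt]) auto
    then show ?thesis by (simp add: prob_space)
  qed
  ultimately have "c / 4 * ?S \<le> objective M D f x1 - optimal_value M D f + real N * (?Q * ?T)"
    by linarith
  then have le: "4 / (c * (real N * real K)) * (c / 4 * ?S) \<le>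
      4 / (c * (real N * real K)) * (objective M D f x1 - optimal_value M D f + real N * (?Q * ?T))"
    using c by (intro mult_left_mono) auto
  have "1 / (real N * real K) * ?S = 4 / (c * (real N * real K)) * (c / 4 * ?S)"
    using c by simp
  also note le
  also have "4 / (c * (real N * real K)) * (objective M D f x1 - optimal_value M D f + real N * (?Q * ?T)) =
      4 * (objective M D f x1 - optimal_value M D f) / (c * (real N * real K)) +
      4 / (c * (real N * real K)) * (real N * (?Q * ?T))"
    by (simp only: distrib_left times_divide_eq_left)
  also have "4 / (c * (real N * real K)) * (real N * (?Q * ?T)) = 4 * ?Q * (c * L * \<sigma>\<^sup>2)"
    using c N K by (simp add: power2_eq_square field_simps)
  finally show ?thesis .
qed

end

section \<open>Choice of the constants and the threshold\<close>

theorem corollary1p3: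
  fixes L \<sigma> \<kappa> \<Delta> :: real and s :: nat
  assumes "L > 0" and "\<sigma> \<ge> 0" and "\<kappa> \<ge> 0" and "s \<ge> 1"
  shows "let q = real CARD('d :: {finite, linorder}) / (4 * (real s)\<^sup>2) in
    \<exists>C>0. \<forall>M K :: nat.
    M \<ge> 1 \<longrightarrow> K \<ge> 1 \<longrightarrow> M dvd CARD('d) \<longrightarrow>
    real M \<le> real CARD('d) * (1 + q) * inverse (exp q - q - 1) \<longrightarrow>
    (\<kappa> > 0 \<longrightarrow> real K \<le> \<sigma>\<^sup>2 / (2 * \<kappa>\<^sup>2) * (1 + 2 * exp (- q))) \<longrightarrow>
    (\<exists>N0. \<forall>N\<ge>N0. \<forall>(D :: nat \<Rightarrow> 'w measure) (f :: nat \<Rightarrow> real ^ ('d :: {finite, linorder}) \<Rightarrow> 'w \<Rightarrow> real) x1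
        (P :: 'p measure) \<xi> u.
      stochastic_problem M D f \<longrightarrow>
      smooth_workers M D f L \<longrightarrow>
      bounded_variance M D f \<sigma> \<kappa> \<longrightarrow>
      objective M D f x1 - optimal_value M D f = \<Delta> \<longrightarrow>
      algorithm_randomness N M K D P \<xi> u \<longrightarrow>
      (let \<gamma> = (\<lambda>_. sqrt (real M) / (L * sqrt (real N * real K)));
           grad_sq = (\<lambda>n k \<omega>. (norm (grad (objective M D f)
             (ar_average M K s f \<gamma> x1 (\<lambda>n k m. \<xi> n k m \<omega>) (\<lambda>n j t i. u n j t i \<omega>) n k)))\<^sup>2)
       in (\<forall>n<N. \<forall>k<K. integrable P (grad_sq n k)) \<and>
          1 / (real N * real K) * (\<Sum>n<N. \<Sum>k<K. \<integral>\<omega>. grad_sq n k \<omega> \<partial>P)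
            \<le> C / sqrt (real N * real K * real M)))"
proof -
  define d where "d = CARD('d)"
  define q where "q = real CARD('d) / (4 * (real s)\<^sup>2)"
  define Q where "Q = 16 + 28 * quant_const d"
  \<comment> \<open>Chosen before \<open>M\<close> and \<open>K\<close>. The absolute value and the
    summand 1 keep it positive for every real \<open>\<Delta>\<close>, even when
    \<open>\<Delta>\<close> and \<open>\<sigma>\<close> vanish.\<close>
  define C where "C = 4 * L * \<bar>\<Delta>\<bar> + 4 * Q * \<sigma>\<^sup>2 * real d + 1"
  have Q: "0 \<le> quant_const d" "0 \<le> Q" by (auto simp: Q_def quant_const_def)
  have C: "C > 0" using assms Q by (auto simp: C_def intro!: add_nonneg_pos)
  have main: "(\<forall>n<N. \<forall>k<K. integrable P (\<lambda>\<omega>. (norm (grad (objective M D f)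
             (ar_average M K s f (\<lambda>_. c) x1 (\<lambda>n k m. \<xi> n k m \<omega>) (\<lambda>n j t i. u n j t i \<omega>) n k)))\<^sup>2)) \<and>
      1 / (real N * real K) * (\<Sum>n<N. \<Sum>k<K. \<integral>\<omega>. (norm (grad (objective M D f)
             (ar_average M K s f (\<lambda>_. c) x1 (\<lambda>n k m. \<xi> n k m \<omega>) (\<lambda>n j t i. u n j t i \<omega>) n k)))\<^sup>2 \<partial>P)
        \<le> C / sqrt (real N * real K * real M)"
    if step: "c = sqrt (real M) / (L * sqrt (real N * real K))"
      and workers: "M \<ge> 1" "M dvd CARD('d)" and K: "K \<ge> 1" and N: "N \<ge> 1"
      and \<kappa>: "\<kappa> > 0 \<longrightarrow> real K \<le> \<sigma>\<^sup>2 / (2 * \<kappa>\<^sup>2) * (1 + 2 * exp (- q))"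
      and large: "(96 * quant_const d * (real K)\<^sup>2)\<^sup>2 * real M \<le> real N"
      and run: "stochastic_problem M D f" "smooth_workers M D f L" "bounded_variance M D f \<sigma> \<kappa>"
        "algorithm_randomness N M K D P \<xi> u"
      and \<Delta>: "objective M D f x1 - optimal_value M D f = \<Delta>"
    for M K N :: nat and c and D :: "nat \<Rightarrow> 'w measure" and f :: "nat \<Rightarrow> (real, 'd) vec \<Rightarrow> 'w \<Rightarrow> real" and x1
      and P :: "'p measure" and \<xi> u
  proof -
    have sq: "0 < sqrt (real N * real K)" "0 < sqrt (real M)" using N K workers by auto
    have "c > 0" using step sq assms by simp
    then interpret ar_run P N M K s D f c L \<sigma> \<kappa> x1 \<xi> u
      using workers run assms(1,4) by (intro ar_run.intro ar_run_axioms.intro)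
        (auto simp: algorithm_randomness_def)
    have cL: "c * L = sqrt (real M) / sqrt (real N * real K)"
      using step assms(1) by simp
    have \<kappa>': "real K * \<kappa>\<^sup>2 \<le> 2 * \<sigma>\<^sup>2"
    proof (cases "\<kappa> > 0")
      case True
      have "exp (- q) \<le> 1" by (simp add: q_def)
      \<comment> \<open>The last factor is at most 3; rounding it up to 4 gives the clean form
        \<open>2 * \<sigma>\<^sup>2 / \<kappa>\<^sup>2\<close>.\<close>
      then have "\<sigma>\<^sup>2 / (2 * \<kappa>\<^sup>2) * (1 + 2 * exp (- q)) \<le> \<sigma>\<^sup>2 / (2 * \<kappa>\<^sup>2) * 4"
        by (intro mult_left_mono) (linarith, simp)
      then have "real K \<le> \<sigma>\<^sup>2 / (2 * \<kappa>\<^sup>2) * 4" using \<kappa> True by linarith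
      then show ?thesis using True by (simp add: field_simps)
    qed (use assms(3) in simp)
    have small: "96 * quant_const CARD('d) * (real K)\<^sup>2 * (c * L) \<le> 1"
    proof -
      \<comment> \<open>With \<open>c * L\<close> equal to \<open>sqrt M / sqrt (N * K)\<close>, the
        smallness condition squared asks for
        \<open>(96 * quant_const d * K\<^sup>2)\<^sup>2 * M \<le> N * K\<close>.\<close>
      have "real N * 1 \<le> real N * real K" using K by (intro mult_left_mono) auto
      then have "(96 * quant_const d * (real K)\<^sup>2)\<^sup>2 * real M \<le> real N * real K" using large by linarith
      then have "sqrt ((96 * quant_const d * (real K)\<^sup>2)\<^sup>2 * real M) \<le> sqrt (real N * real K)"
        by (rule real_sqrt_le_mono)
      then have "96 * quant_const d * (real K)\<^sup>2 * sqrt (real M) \<le> sqrt (real N * real K)"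
        using Q by (simp add: real_sqrt_mult)
      then show ?thesis unfolding cL using sq by (simp add: d_def)
    qed
    have s2: "real N * real K = sqrt (real N * real K) * sqrt (real N * real K)" by simp
    have a: "4 * \<Delta> / (c * (real N * real K)) = 4 * L * \<Delta> / sqrt (real N * real K * real M)"
    proof -
      have "4 * \<Delta> / (g / (L * h) * (h * h)) = 4 * L * \<Delta> / (h * g)" if "0 < h" "0 < g" for g h
        using that assms(1) by (simp add: field_simps)
      from this[OF sq] show ?thesis
        by (simp only: step real_sqrt_mult[of "real N * real K" "real M"] s2[symmetric])
    qed
    have b: "c * L = real M / sqrt (real N * real K * real M)"
    proof -
      have "g / h = g * g / (h * g)" if "0 < h" "0 < g" for g h :: real
        using that by simp
      moreover have "sqrt (real M) * sqrt (real M) = real M" by simp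
      ultimately show ?thesis
        using sq by (simp only: cL real_sqrt_mult[of "real N * real K" "real M"])
    qed
    have "1 / (real N * real K) * (\<Sum>n<N. \<Sum>k<K. A n k) \<le> 4 * \<Delta> / (c * (real N * real K)) + 4 * Q * (c * L * \<sigma>\<^sup>2)"
      using ergodic_bound[OF K N \<kappa>' small] by (simp only: \<Delta> Q_def d_def)
    also have "\<dots> = (4 * L * \<Delta> + 4 * Q * \<sigma>\<^sup>2 * real M) / sqrt (real N * real K * real M)"
      unfolding a b by (simp add: add_divide_distrib)
    also have "\<dots> \<le> C / sqrt (real N * real K * real M)"
    proof (intro divide_right_mono)
      \<comment> \<open>Expressed through the target rate, the noise term \<open>c * L\<close> keeps
        a factor \<open>M\<close>; divisibility bounds it by the dimension.\<close>
      have "real M \<le> real d" using workers unfolding d_def by (intro of_nat_mono dvd_imp_le) auto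
      then have "4 * Q * \<sigma>\<^sup>2 * real M \<le> 4 * Q * \<sigma>\<^sup>2 * real d" using Q by (intro mult_left_mono) auto
      moreover have "4 * L * \<Delta> \<le> 4 * L * \<bar>\<Delta>\<bar>" using assms(1) by (intro mult_left_mono) auto
      ultimately show "4 * L * \<Delta> + 4 * Q * \<sigma>\<^sup>2 * real M \<le> C" by (simp add: C_def)
    qed simp
    finally show ?thesis
      unfolding ar_average_eq A_def by auto
  qed
  show ?thesis
    unfolding Let_def q_def[symmetric]
  proof (intro exI[of _ C] conjI C allI impI, goal_cases)
    case (1 M K)
    note outer = 1
    \<comment> \<open>The threshold may depend on \<open>M\<close> and \<open>K\<close>; the added 1
      secures \<open>N \<ge> 1\<close>.\<close>
    define N0 where "N0 = nat \<lceil>(96 * quant_const d * (real K)\<^sup>2)\<^sup>2 * real M\<rceil> + 1"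
    show ?case
    proof (intro exI[of _ N0] allI impI, goal_cases)
      case (1 N D f x1 P \<xi> u)
      have "(96 * quant_const d * (real K)\<^sup>2)\<^sup>2 * real M \<le> real N" "N \<ge> 1"
        using 1(1) unfolding N0_def by linarith+
      then show ?case
        using main[OF refl outer(1,3,2) _ outer(5) _ 1(2-4) 1(6) 1(5)] by blast
    qed
  qed
qed

end
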